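(* Let $g_E=h_E^4(t)\,g_o=\bigl(1+EH(t)+E^2G(t)+\mathcal{O}(E^3)\bigr)g_o$ be a deformation of the flat metric $g_o=dt^2+dy^2$ on the torus $T^2$ such that $h_E^4(t)=h_E^4(1-t)$ for all $t$ and all $E$, and $$\int_0^1H(t)\sin^2(2\pi t)\,dt=\int_0^1H(t)\cos^2(2\pi t)\,dt=0 .$$ Let $\mu_\alpha(E)$ and $\lambda_\alpha^2(E)$, $\alpha=1,2,3$, be the spectral functions of the Laplace operator and of the square of the Dirac operator of $g_E$ described in the context. Suppose that for $E\neq0$ the numbers $\mu_1(E)\neq\mu_2(E)$ are simple eigenvalues of the periodic problem $-A''(t)=\mu\,h_E^4(t)A(t)$ (the case $k=0$). Then, with two dots denoting the second derivative with respect to $E$: (a) $\ddot\mu_1(0)=-16\pi^2\int_0^1G(t)\sin^2(2\pi t)\,dt-16\pi^2\int_0^1H(t)C(t)\sin(2\pi t)\,dt$, where $C$ is a $1$-periodic solution of $C''(t)=-4\pi^2H(t)\sin(2\pi t)-4\pi^2C(t)$. (b) $\ddot\mu_2(0)=-16\pi^2\int_0^1G(t)\cos^2(2\pi t)\,dt-16\pi^2\int_0^1H(t)C(t)\cos(2\pi t)\,dt$, where $C$ is a $1$-periodic solution of $C''(t)=-4\pi^2H(t)\cos(2\pi t)-4\pi^2C(t)$. (c) $\ddot\mu_3(0)=-8\pi^2\int_0^1G(t)\,dt-8\pi^2\int_0^1H(t)C(t)\,dt$, where $C$ is a $1$-periodic solution of $C''(t)=-4\pi^2H(t)$. (d) $\ddot{(\lambda_1^2)}(0)=-8\pi^2\int_0^1G(t)\,dt+2\pi^2\int_0^1H^2(t)\,dt$.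 (e) $\ddot{(\lambda_2^2)}(0)=\ddot{(\lambda_3^2)}(0)=-8\pi^2\int_0^1G(t)\,dt+4\pi^2\int_0^1H^2(t)\,dt-8\pi^2\int_0^1H(t)C(t)\,dt-2\pi\int_0^1H'(t)C(t)\,dt$, where $C$ is a $1$-periodic solution of $C''(t)=-4\pi^2H(t)-\pi H'(t)$.
   Context: $T^2=\mathbb{R}^2/\mathbb{Z}^2$ with coordinates $0\le t\le 1$, $0\le y\le 1$ and the trivial spin structure. A deformation of the flat metric means a family $g_E=h_E^4(t)g_o$, where $h_E$ is a positive $1$-periodic function depending smoothly on $(E,t)$, for $E$ in an interval around $0$, with $h_0\equiv 1$. Derivatives in $t$ are denoted by $'$. Functions of the form $A(t)e^{2\pi i k y}$, $k\in\mathbb{Z}$, are eigenfunctions of the (positive) Laplace operator $\Delta_{g_E}$ with eigenvalue $\mu$ iff $A$ is a $1$-periodic nontrivial solution of $$-A''(t)=\{\mu\,h_E^4(t)-4\pi^2k^2\}A(t).$$ Sections of the positive half-spinor bundle $S^+$ of weight $l\in\mathbb{Z}$ under the isometric $S^1$-action in the $y$-variable are given by functions $A(t)e^{2\pi i l y}$, and they are eigenspinors of $D_{g_E}^2$ with eigenvalue $\lambda^2$ iff $A$ is a $1$-periodic nontrivial solution of $$-A''(t)=\Bigl\{\lambda^2 h_E^4(t)+\frac{h_E(t)h_E''(t)-2(h_E'(t))^2}{h_E^2(t)}-4\pi^2l^2+4\pi l\,\frac{h_E'(t)}{h_E(t)}\Bigr\}A(t).$$ At $E=0$ the first positive eigenvalue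 of each of $\Delta_{g_o}$ and $D_{g_o}^2|_{S^+}$ is $4\pi^2$, of multiplicity four. The spectral functions are the branches (smooth in $E$, with smooth families of eigenfunctions) with value $4\pi^2$ at $E=0$: - $\mu_1(E)$ and $\mu_2(E)$: eigenvalues of the Laplace problem with $k=0$ whose eigenfunctions are deformations of $\sin(2\pi t)$ and $\cos(2\pi t)$, respectively; - $\mu_3(E)$: the eigenvalue of the Laplace problem with $k=\pm1$ whose eigenfunction is a deformation of the constant function $1$; - $\lambda_1^2(E)$: the eigenvalue (of multiplicity two) of the Dirac problem with $l=0$; - $\lambda_2^2(E),\lambda_3^2(E)$: the eigenvalues of the Dirac problem with $l=-1$ and $l=1$, respectively, whose eigenfunctions are deformations of the constant function $1$. *)

theory Defs
  imports "HOL-Analysis.Analysis" "HOL-Library.Function_Algebras" "HOL-Library.Landau_Symbols"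
begin

(* C^k and C^infinity maps, meant for open S: all iterated directional derivatives up to order k
   exist as total derivatives and are continuous. *)
primrec C_k_on :: "nat \<Rightarrow> 'a::real_normed_vector set \<Rightarrow> ('a \<Rightarrow> 'b::real_normed_vector) \<Rightarrow> bool" where
  "C_k_on 0 S f \<longleftrightarrow> continuous_on S f"
| "C_k_on (Suc k) S f \<longleftrightarrow> (\<forall>x\<in>S. f differentiable (at x)) \<and>
     (\<forall>v. C_k_on k S (\<lambda>x. frechet_derivative f (at x) v))"

definition smooth_on :: "'a::real_normed_vector set \<Rightarrow> ('a \<Rightarrow> 'b::real_normed_vector) \<Rightarrow> bool" where
  "smooth_on S f \<longleftrightarrow> (\<forall>k. C_k_on k S f)"

definition one_periodic :: "(real \<Rightarrow> real) \<Rightarrow> bool" where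
  "one_periodic f \<longleftrightarrow> (\<forall>t. f (t + 1) = f t)"

(* C is a 1-periodic solution of C''(t) = F t (C t). *)
definition periodic_solution :: "(real \<Rightarrow> real \<Rightarrow> real) \<Rightarrow> (real \<Rightarrow> real) \<Rightarrow> bool" where
  "periodic_solution F C \<longleftrightarrow> one_periodic C \<and>
     (\<exists>C'. \<forall>t. (C has_real_derivative C' t) (at t) \<and>
               (C' has_real_derivative F t (C t)) (at t))"

(* h E t is the conformal factor: g_E = h_E^4 (dt^2 + dy^2), for E in an interval I around 0. *)
definition metric_deformation :: "real set \<Rightarrow> (real \<Rightarrow> real \<Rightarrow> real) \<Rightarrow> bool" where
  "metric_deformation I h \<longleftrightarrow>
     open I \<and> is_interval I \<and> 0 \<in> I \<and>
     smooth_on (I \<times> UNIV) (\<lambda>(E, t). h E t) \<and>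
     (\<forall>E\<in>I. one_periodic (h E) \<and> (\<forall>t. 0 < h E t)) \<and>
     (\<forall>t. h 0 t = 1)"

(* The coefficients q in -A'' = q A for functions A(t) exp(2 pi i k y), respectively spinors
   A(t) exp(2 pi i l y) in S^+, to be eigenfunctions of the Laplace operator with eigenvalue mu,
   respectively of the square of the Dirac operator with eigenvalue nu = lambda^2;
   here f is the conformal factor h_E of a single metric. *)
definition laplace_coeff :: "int \<Rightarrow> (real \<Rightarrow> real) \<Rightarrow> real \<Rightarrow> real \<Rightarrow> real" where
  "laplace_coeff k f \<mu> t = \<mu> * f t ^ 4 - 4 * pi\<^sup>2 * (of_int k)\<^sup>2"

definition dirac_coeff :: "int \<Rightarrow> (real \<Rightarrow> real) \<Rightarrow> real \<Rightarrow> real \<Rightarrow> real" where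
  "dirac_coeff l f \<nu> t =
     \<nu> * f t ^ 4 + (f t * deriv (deriv f) t - 2 * (deriv f t)\<^sup>2) / (f t)\<^sup>2
       - 4 * pi\<^sup>2 * (of_int l)\<^sup>2 + 4 * pi * of_int l * (deriv f t / f t)"

definition eigenspace :: "(real \<Rightarrow> real) \<Rightarrow> (real \<Rightarrow> real) set" where
  "eigenspace q = {A. periodic_solution (\<lambda>t x. - (q t * x)) A}"

global_interpretation fun_space: vector_space "\<lambda>(c::real) (A::real \<Rightarrow> real) t. c * A t"
  by unfold_locales (auto simp: fun_eq_iff algebra_simps)

definition multiplicity_of :: "(real \<Rightarrow> real) \<Rightarrow> nat" where
  "multiplicity_of q = fun_space.dim (eigenspace q)"

(* nu is a smooth eigenvalue branch on I through 4 pi^2 of a problem -A'' = Q E (nu E) A, with a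
   smooth family of (nontrivial) eigenfunctions deforming A0. *)
definition spectral_function ::
  "real set \<Rightarrow> (real \<Rightarrow> real \<Rightarrow> real \<Rightarrow> real) \<Rightarrow> (real \<Rightarrow> real) \<Rightarrow> (real \<Rightarrow> real) \<Rightarrow> bool" where
  "spectral_function I Q \<nu> A0 \<longleftrightarrow>
     smooth_on I \<nu> \<and> \<nu> 0 = 4 * pi\<^sup>2 \<and>
     (\<exists>A. smooth_on (I \<times> UNIV) (\<lambda>(E, t). A E t) \<and> A 0 = A0 \<and>
          (\<forall>E\<in>I. A E \<in> eigenspace (Q E (\<nu> E)) \<and> (\<exists>t. A E t \<noteq> 0)))"

abbreviation laplace_spectral_function where
  "laplace_spectral_function I h k \<equiv> spectral_function I (\<lambda>E. laplace_coeff k (h E))"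

abbreviation dirac_spectral_function where
  "dirac_spectral_function I h l \<equiv> spectral_function I (\<lambda>E. dirac_coeff l (h E))"

end

(*
  Differentiate the eigenvalue equation in E and pair it with an unperturbed solution: the pairing is
  the t-derivative of a periodic function, so its E-derivatives integrate to zero over a period. The
  first such identity makes the first derivative of the eigenvalue vanish, the second one gives the
  formula for the second derivative, with C the first variation of the eigenfunction.

  For the Dirac problem, u = h A and w = (u' - 2 pi l u) / h^2 satisfy the first-order system
  u' = 2 pi l u + h^2 w, w' = - 2 pi l w - nu h^2 u, which contains no derivatives of h; the function C
  of part (e) is the first variation of u. For l = 0 the system is a rotation with angular velocity
  sqrt(nu) h^2, hence near E = 0 periodicity forces sqrt(nu) * (integral of h^2) = 2 pi.
*)

theory Submission
  imports Defs
begin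

section \<open>Continuously differentiable maps\<close>

text \<open>The eigenfunction branches are not normalised, so the first variation is one particular
  \<open>C\<close>, whereas the formulas are claimed for every periodic \<open>C\<close>. Two
  choices differ by an unperturbed solution, which is harmless if the matrix elements of
  \<open>H\<close> on the unperturbed solutions vanish. In (a) and (b) these solutions are spanned
  by sin and cos: the two integral hypotheses give the diagonal elements, the reflection symmetry
  gives the mixed one. In (c) and (e) the ambiguity is a constant, and \<open>H\<close> and
  \<open>deriv H\<close> have mean zero.

  The Dirac coefficient contains \<open>h''\<close>. The remedy comes from conformal covariance of
  the Dirac operator: u and w are the rescaled components of the eigenspinor and of its image, and
  only \<open>r = h^2\<close> survives. As \<open>h^4 = r^2\<close>, the same \<open>r\<close>
  serves the Laplace problem.

  In (d) the eigenvalue is double and no initial eigenfunction is prescribed; an exact formula for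
  the eigenvalue therefore replaces the perturbation of eigenfunctions. In (e) the weight -1 leads
  to an equation for \<open>C\<close> with the opposite sign of \<open>deriv H\<close>, so a
  separate identity must relate the solutions of the two equations.\<close>

lemma frechet_derivative_eqI:
  "(f has_derivative f') (at x) \<Longrightarrow> frechet_derivative f (at x) = f'"
  using frechet_derivative_at by blast

lemma C_k_on_Suc_imp: "C_k_on (Suc k) S f \<Longrightarrow> C_k_on k S f"
proof (induction k arbitrary: f)
  case 0
  then show ?case
    by (auto intro!: continuous_at_imp_continuous_on differentiable_imp_continuous_within)
next
  case (Suc k)
  then show ?case by (metis C_k_on.simps(2))
qed

lemma C_k_on_cong:
  assumes "open S" "\<And>x. x \<in> S \<Longrightarrow> f x = g x" "C_k_on k S f"
  shows "C_k_on k S g"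
  using assms(2,3)
proof (induction k arbitrary: f g)
  case 0
  then show ?case by (auto cong: continuous_on_cong)
next
  case (Suc k)
  have der: "(g has_derivative frechet_derivative f (at x)) (at x)" if "x \<in> S" for x
  proof (rule has_derivative_transform_within_open[OF _ assms(1) that])
    show "(f has_derivative frechet_derivative f (at x)) (at x)"
      using Suc.prems(2) that frechet_derivative_works by auto
  qed (use Suc.prems(1) in auto)
  have "C_k_on k S (\<lambda>x. frechet_derivative g (at x) v)" for v
    by (rule Suc.IH[of "\<lambda>x. frechet_derivative f (at x) v"])
      (use Suc.prems(2) frechet_derivative_eqI[OF der] in auto)
  then show ?case
    using der by (auto simp: differentiable_def)
qed

text \<open>\<open>frechet_derivative\<close> is defined by choice and cannot be computed. This rule
  lets the closure proofs name an explicit derivative; uniqueness of derivatives does the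
  rest.\<close>

lemma C_k_on_SucI:
  assumes "open S" and f: "\<And>x. x \<in> S \<Longrightarrow> (f has_derivative f' x) (at x)"
    and f': "\<And>v. C_k_on k S (\<lambda>x. f' x v)"
  shows "C_k_on (Suc k) S f"
proof -
  have "C_k_on k S (\<lambda>x. frechet_derivative f (at x) v)" for v
    by (rule C_k_on_cong[OF assms(1) _ f'[of v]]) (simp add: frechet_derivative_eqI[OF f])
  then show ?thesis
    using f by (auto simp: differentiable_def)
qed

lemma C_k_on_has_derivative:
  "C_k_on (Suc k) S f \<Longrightarrow> x \<in> S \<Longrightarrow> (f has_derivative frechet_derivative f (at x)) (at x)"
  using frechet_derivative_works by auto

lemma C_k_on_const: "open S \<Longrightarrow> C_k_on k S (\<lambda>x. c)"
proof (induction k arbitrary: c)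
  case (Suc k)
  show ?case
    by (rule C_k_on_SucI[where f'="\<lambda>_ _. 0"]) (use Suc in auto)
qed simp

lemma C_k_on_add:
  "open S \<Longrightarrow> C_k_on k S f \<Longrightarrow> C_k_on k S g \<Longrightarrow> C_k_on k S (\<lambda>x. f x + g x)"
proof (induction k arbitrary: f g)
  case (Suc k)
  show ?case
    by (rule C_k_on_SucI[OF Suc.prems(1)
          has_derivative_add[OF C_k_on_has_derivative[OF Suc.prems(2)]
            C_k_on_has_derivative[OF Suc.prems(3)]]])
      (use Suc in auto)
qed (simp add: continuous_on_add)

lemma C_k_on_mult:
  fixes f g :: "'a::real_normed_vector \<Rightarrow> 'b::real_normed_algebra"
  shows "open S \<Longrightarrow> C_k_on k S f \<Longrightarrow> C_k_on k S g \<Longrightarrow> C_k_on k S (\<lambda>x. f x * g x)"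
proof (induction k arbitrary: f g)
  case (Suc k)
  show ?case
    by (rule C_k_on_SucI[OF Suc.prems(1)
          has_derivative_mult[OF C_k_on_has_derivative[OF Suc.prems(2)]
            C_k_on_has_derivative[OF Suc.prems(3)]]])
      (use Suc C_k_on_Suc_imp[OF Suc.prems(2)] C_k_on_Suc_imp[OF Suc.prems(3)] in
        \<open>auto intro!: C_k_on_add\<close>)
qed (simp add: continuous_on_mult)

lemma C_k_on_inverse:
  fixes f :: "'a::real_normed_vector \<Rightarrow> 'b::real_normed_div_algebra"
  shows "open S \<Longrightarrow> (\<And>x. x \<in> S \<Longrightarrow> f x \<noteq> 0) \<Longrightarrow> C_k_on k S f \<Longrightarrow> C_k_on k S (\<lambda>x. inverse (f x))"
proof (induction k)
  case (Suc k)
  have inv: "C_k_on k S (\<lambda>x. inverse (f x))"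
    using Suc C_k_on_Suc_imp by blast
  \<comment> \<open>The derivative of the inverse involves only the inverse itself, of class C^k by
    induction, and \<open>f\<close>; closure under products then finishes.\<close>
  have "C_k_on k S (\<lambda>x. (- 1) * (inverse (f x) * frechet_derivative f (at x) v * inverse (f x)))" for v
    by (intro C_k_on_mult C_k_on_const inv) (use Suc.prems in auto)
  then show ?case
    by (intro C_k_on_SucI[OF Suc.prems(1)
          Deriv.has_derivative_inverse[OF Suc.prems(2) C_k_on_has_derivative[OF Suc.prems(3)]]]) auto
qed (simp add: continuous_on_inverse)

text \<open>An affine inner map has a constant derivative, so the induction needs no products. This
  covers the two compositions that occur: projection to the parameter and freezing the
  parameter.\<close>

lemma C_k_on_compose_affine:
  assumes "open T" "bounded_linear L" "\<And>x. x \<in> T \<Longrightarrow> L x + c \<in> S" "C_k_on k S f"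
  shows "C_k_on k T (\<lambda>x. f (L x + c))"
  using assms(4)
proof (induction k arbitrary: f)
  case 0
  then show ?case
    using assms(3) by (auto intro!: continuous_on_compose2[of S f] continuous_intros
        linear_continuous_on[OF assms(2)])
next
  case (Suc k)
  show ?case
  proof (rule C_k_on_SucI[OF assms(1)])
    show "((\<lambda>x. f (L x + c)) has_derivative (\<lambda>v. frechet_derivative f (at (L x + c)) (L v))) (at x)"
      if "x \<in> T" for x
      by (rule has_derivative_compose[where f="\<lambda>x. L x + c", OF _
            C_k_on_has_derivative[OF Suc.prems assms(3)[OF that]]])
        (auto intro!: derivative_eq_intros bounded_linear_imp_has_derivative assms(2))
    show "C_k_on k T (\<lambda>x. frechet_derivative f (at (L x + c)) (L v))" for v
      using Suc by auto
  qed
qed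

section \<open>Smooth families of functions\<close>

definition smooth_family :: "real set \<Rightarrow> (real \<Rightarrow> real \<Rightarrow> real) \<Rightarrow> bool" where
  "smooth_family I F \<longleftrightarrow> smooth_on (I \<times> UNIV) (\<lambda>(E, t). F E t)"

text \<open>Taken from the total derivative of the joint map, so that smoothness of the partial
  derivative is immediate from the recursive definition of \<open>C_k_on\<close>; the same holds for
  \<open>dT\<close>.\<close>

definition dE :: "(real \<Rightarrow> real \<Rightarrow> real) \<Rightarrow> real \<Rightarrow> real \<Rightarrow> real" where
  "dE F E t = frechet_derivative (\<lambda>(E, t). F E t) (at (E, t)) (1, 0)"

definition dT :: "(real \<Rightarrow> real \<Rightarrow> real) \<Rightarrow> real \<Rightarrow> real \<Rightarrow> real" where
  "dT F E t = frechet_derivative (\<lambda>(E, t). F E t) (at (E, t)) (0, 1)"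

lemma smooth_on_Suc: "smooth_on S f \<Longrightarrow> C_k_on (Suc k) S f"
  unfolding smooth_on_def by blast

lemma smooth_on_has_derivative:
  "smooth_on S f \<Longrightarrow> x \<in> S \<Longrightarrow> (f has_derivative frechet_derivative f (at x)) (at x)"
  using C_k_on_has_derivative smooth_on_Suc by blast

lemma smooth_on_frechet_derivative:
  "smooth_on S f \<Longrightarrow> smooth_on S (\<lambda>x. frechet_derivative f (at x) v)"
  unfolding smooth_on_def using C_k_on.simps(2) by blast

lemma smooth_family_dE: "smooth_family I F \<Longrightarrow> smooth_family I (dE F)"
  using smooth_on_frechet_derivative[of "I \<times> UNIV" "\<lambda>(E, t). F E t" "(1, 0)"]
  by (simp add: smooth_family_def dE_def split_def)

lemma smooth_family_dT: "smooth_family I F \<Longrightarrow> smooth_family I (dT F)"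
  using smooth_on_frechet_derivative[of "I \<times> UNIV" "\<lambda>(E, t). F E t" "(0, 1)"]
  by (simp add: smooth_family_def dT_def split_def)

lemma dE_has_derivative:
  assumes "smooth_family I F" "E \<in> I"
  shows "((\<lambda>E. F E t) has_real_derivative dE F E t) (at E)"
proof -
  let ?f = "\<lambda>(E, t). F E t"
  have D: "(?f has_derivative frechet_derivative ?f (at (E, t))) (at (E, t))"
    using assms smooth_on_has_derivative unfolding smooth_family_def by blast
  have "((\<lambda>e. ?f (e, t)) has_derivative (\<lambda>d. frechet_derivative ?f (at (E, t)) (d, 0))) (at E)"
    by (rule has_derivative_compose[where f="\<lambda>e. (e, t)", OF _ D])
      (auto intro!: derivative_eq_intros)
  moreover have "frechet_derivative ?f (at (E, t)) (d, 0) = d * dE F E t" for d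
    using linear_scale[OF has_derivative_linear[OF D], of d "(1, 0)"] by (simp add: dE_def)
  ultimately show ?thesis
    by (simp add: has_field_derivative_def mult_commute_abs)
qed

lemma dT_has_derivative:
  assumes "smooth_family I F" "E \<in> I"
  shows "(F E has_real_derivative dT F E t) (at t)"
proof -
  let ?f = "\<lambda>(E, t). F E t"
  have D: "(?f has_derivative frechet_derivative ?f (at (E, t))) (at (E, t))"
    using assms smooth_on_has_derivative unfolding smooth_family_def by blast
  have "((\<lambda>s. ?f (E, s)) has_derivative (\<lambda>d. frechet_derivative ?f (at (E, t)) (0, d))) (at t)"
    by (rule has_derivative_compose[where f="\<lambda>s. (E, s)", OF _ D])
      (auto intro!: derivative_eq_intros)
  moreover have "frechet_derivative ?f (at (E, t)) (0, d) = d * dT F E t" for d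
    using linear_scale[OF has_derivative_linear[OF D], of d "(0, 1)"] by (simp add: dT_def)
  ultimately show ?thesis
    by (simp add: has_field_derivative_def mult_commute_abs)
qed

text \<open>The working rule for computing E-derivatives: as \<open>I\<close> is open, a formula for
  \<open>F\<close> that is valid on \<open>I\<close> alone suffices.\<close>

lemma dE_eqI:
  assumes "open I" "smooth_family I F" "E \<in> I"
    and "\<And>E. E \<in> I \<Longrightarrow> F E t = g E" "(g has_real_derivative d) (at E)"
  shows "dE F E t = d"
proof (rule DERIV_unique[OF dE_has_derivative[OF assms(2,3)]])
  show "((\<lambda>E. F E t) has_real_derivative d) (at E)"
    using assms by (auto elim!: has_field_derivative_transform_within_open)
qed

lemma smooth_family_continuous:
  assumes "smooth_family I F"
  shows "continuous_on (I \<times> UNIV) (\<lambda>(E, t). F E t)"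
  using assms unfolding smooth_family_def smooth_on_def by (auto dest: spec[of _ 0])

lemma smooth_family_continuous_t:
  assumes "smooth_family I F" "E \<in> I"
  shows "continuous_on S (F E)"
  using dT_has_derivative[OF assms]
  by (auto intro!: continuous_at_imp_continuous_on dest: DERIV_isCont)

lemma smooth_family_const: "open I \<Longrightarrow> smooth_family I (\<lambda>_ _. c)"
  by (simp add: smooth_family_def smooth_on_def split_def C_k_on_const open_Times)

lemma smooth_family_parameter: "open I \<Longrightarrow> smooth_on I f \<Longrightarrow> smooth_family I (\<lambda>E _. f E)"
  unfolding smooth_family_def smooth_on_def split_def
  using C_k_on_compose_affine[of "I \<times> UNIV" fst 0 I _ f]
  by (auto simp: open_Times bounded_linear_fst)

text \<open>Needed because the pairing for the Laplace problem multiplies the moving eigenfunction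
  by the fixed one \<open>A 0\<close>.\<close>

lemma smooth_family_freeze:
  "open I \<Longrightarrow> smooth_family I F \<Longrightarrow> e \<in> I \<Longrightarrow> smooth_family I (\<lambda>_. F e)"
  unfolding smooth_family_def smooth_on_def split_def
  using C_k_on_compose_affine[of "I \<times> UNIV" "\<lambda>x. (0, snd x)" "(e, 0)"
      "I \<times> UNIV" _ "\<lambda>x. F (fst x) (snd x)"]
  by (auto simp: open_Times bounded_linear_Pair bounded_linear_snd)

lemma smooth_family_add:
  "open I \<Longrightarrow> smooth_family I F \<Longrightarrow> smooth_family I G \<Longrightarrow> smooth_family I (\<lambda>E t. F E t + G E t)"
  by (simp add: smooth_family_def smooth_on_def split_def C_k_on_add open_Times)

lemma smooth_family_mult:
  "open I \<Longrightarrow> smooth_family I F \<Longrightarrow> smooth_family I G \<Longrightarrow> smooth_family I (\<lambda>E t. F E t * G E t)"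
  by (simp add: smooth_family_def smooth_on_def split_def C_k_on_mult open_Times)

lemma smooth_family_minus:
  "open I \<Longrightarrow> smooth_family I F \<Longrightarrow> smooth_family I (\<lambda>E t. - F E t)"
  using smooth_family_mult[OF _ smooth_family_const[of I "- 1"], of F] by simp

lemma smooth_family_diff:
  "open I \<Longrightarrow> smooth_family I F \<Longrightarrow> smooth_family I G \<Longrightarrow> smooth_family I (\<lambda>E t. F E t - G E t)"
  using smooth_family_add[OF _ _ smooth_family_minus, of I F G] by simp

lemma smooth_family_power:
  "open I \<Longrightarrow> smooth_family I F \<Longrightarrow> smooth_family I (\<lambda>E t. F E t ^ n)"
  by (induction n) (simp_all add: smooth_family_const smooth_family_mult)

lemma smooth_family_divide:
  assumes "open I" "smooth_family I F" "smooth_family I G" "\<And>E t. E \<in> I \<Longrightarrow> G E t \<noteq> 0"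
  shows "smooth_family I (\<lambda>E t. F E t / G E t)"
proof -
  have "smooth_family I (\<lambda>E t. inverse (G E t))"
    using assms by (auto simp: smooth_family_def smooth_on_def split_def intro!: C_k_on_inverse open_Times)
  from smooth_family_mult[OF assms(1,2) this] show ?thesis by (simp add: divide_inverse)
qed

lemmas smooth_family_intros =
  smooth_family_const smooth_family_parameter smooth_family_freeze smooth_family_add smooth_family_mult
  smooth_family_minus smooth_family_diff smooth_family_power smooth_family_dE smooth_family_dT

section \<open>Differentiation under the integral, mixed partial derivatives, solvability
  conditions\<close>

lemma has_derivative_integral_parameter:
  assumes "open I" "smooth_family I F" "E \<in> I"
  shows "((\<lambda>E. integral {a..b} (F E)) has_real_derivative integral {a..b} (dE F E)) (at E)"
proof -
  \<comment> \<open>The Leibniz rule asks for a convex parameter domain; a ball inside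
    \<open>I\<close> provides it.\<close>
  obtain e where e: "e > 0" "ball E e \<subseteq> I"
    using assms(1,3) openE by blast
  have "((\<lambda>E. integral (cbox a b) (F E)) has_real_derivative integral (cbox a b) (dE F E))
      (at E within ball E e)"
  proof (rule leibniz_rule_field_derivative)
    show "((\<lambda>E. F E t) has_real_derivative dE F x t) (at x within ball E e)" if "x \<in> ball E e" for x t
      using dE_has_derivative[OF assms(2)] e that has_field_derivative_at_within by blast
    show "F x integrable_on cbox a b" if "x \<in> ball E e" for x
      using smooth_family_continuous_t[OF assms(2)] e that by (auto intro!: integrable_continuous_real)
    show "continuous_on (ball E e \<times> cbox a b) (\<lambda>(x, t). dE F x t)"
      by (rule continuous_on_subset[OF smooth_family_continuous[OF smooth_family_dE[OF assms(2)]]])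
        (use e in auto)
  qed (use e in auto)
  then show ?thesis
    using e(1) by (simp add: at_within_open[of E "ball E e"])
qed

text \<open>The increment of \<open>F\<close> in t is the integral of \<open>dT F\<close>;
  differentiating it in E under the integral sign and then in the upper limit exchanges the order.
  The base point \<open>t - 1\<close> and the end point \<open>t + 1\<close> make \<open>t\<close>
  interior, so that the derivative within the interval is the full one.\<close>

lemma dE_dT_commute:
  assumes I: "open I" and F: "smooth_family I F" and E: "E \<in> I"
  shows "dE (dT F) E t = dT (dE F) E t"
proof -
  let ?a = "t - 1" and ?b = "t + 1"
  have FTC: "integral {?a..s} (dT F x) = F x s - F x ?a" if "x \<in> I" "s \<in> {?a..?b}" for x s
    using that dT_has_derivative[OF F]
    by (intro integral_unique fundamental_theorem_of_calculus)
      (auto intro: has_field_derivative_at_within simp flip: has_real_derivative_iff_has_vector_derivative)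
  have eq: "dE F E s - dE F E ?a = integral {?a..s} (dE (dT F) E)" if s: "s \<in> {?a..?b}" for s
  proof -
    have "((\<lambda>x. F x s - F x ?a) has_real_derivative integral {?a..s} (dE (dT F) E)) (at E)"
      by (rule has_field_derivative_transform_within_open[OF
            has_derivative_integral_parameter[OF I smooth_family_dT[OF F] E] I E])
        (use FTC s in auto)
    moreover have "((\<lambda>x. F x s - F x ?a) has_real_derivative dE F E s - dE F E ?a) (at E)"
      by (intro DERIV_diff dE_has_derivative[OF F E])
    ultimately show ?thesis using DERIV_unique by blast
  qed
  have "((\<lambda>s. integral {?a..s} (dE (dT F) E)) has_real_derivative dE (dT F) E t) (at t within {?a..?b})"
    by (rule integral_has_real_derivative)
      (use smooth_family_continuous_t[OF smooth_family_dE[OF smooth_family_dT[OF F]] E] in auto)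
  then have "((\<lambda>s. dE F E s - dE F E ?a) has_real_derivative dE (dT F) E t) (at t within {?a..?b})"
    unfolding has_field_derivative_def by (rule has_derivative_transform[rotated 2]) (auto simp: eq)
  then have "((\<lambda>s. dE F E s - dE F E ?a) has_real_derivative dE (dT F) E t) (at t)"
    by (simp add: at_within_interior[of t "{?a..?b}"] interior_atLeastAtMost_real)
  moreover have "((\<lambda>s. dE F E s - dE F E ?a) has_real_derivative dT (dE F) E t - 0) (at t)"
    by (intro DERIV_diff dT_has_derivative[OF smooth_family_dE[OF F] E] DERIV_const)
  ultimately show ?thesis using DERIV_unique by fastforce
qed

lemma one_periodic_dE:
  assumes "open I" "smooth_family I F" "E \<in> I" "\<And>E. E \<in> I \<Longrightarrow> one_periodic (F E)"
  shows "one_periodic (dE F E)"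
  unfolding one_periodic_def
  using assms(4) by (auto intro!: dE_eqI[OF assms(1-3) _ dE_has_derivative[OF assms(2,3)]]
      simp: one_periodic_def)

lemma one_periodic_derivative:
  assumes "\<And>t. (f has_real_derivative f' t) (at t)" "one_periodic f"
  shows "one_periodic f'"
  unfolding one_periodic_def
proof
  fix t
  have "((\<lambda>s. f (s + 1)) has_real_derivative f' (t + 1)) (at t)"
    using assms(1)[of "t + 1"] by (simp add: DERIV_shift)
  then have "(f has_real_derivative f' (t + 1)) (at t)"
    using assms(2) by (simp add: one_periodic_def)
  then show "f' (t + 1) = f' t"
    using assms(1) DERIV_unique by blast
qed

lemma one_periodic_dT:
  "smooth_family I F \<Longrightarrow> E \<in> I \<Longrightarrow> one_periodic (F E) \<Longrightarrow> one_periodic (dT F E)"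
  using one_periodic_derivative dT_has_derivative by blast

lemma periodic_derivative_has_integral:
  assumes "\<And>t. (f has_real_derivative f' t) (at t)" "one_periodic f"
  shows "(f' has_integral 0) {0..1}"
proof -
  have "(f' has_integral f 1 - f 0) {0..1}"
    using assms(1)
    by (intro fundamental_theorem_of_calculus)
      (auto intro: has_field_derivative_at_within simp flip: has_real_derivative_iff_has_vector_derivative)
  moreover have "f 1 = f 0"
    using assms(2) unfolding one_periodic_def by (metis add_0)
  ultimately show ?thesis by simp
qed

text \<open>All solvability conditions of the perturbation expansion come from this lemma, with \<open>V\<close> the
  pairing of an eigenfunction with an unperturbed solution.\<close>

lemma periodic_family_solvability:
  assumes I: "open I" and V: "smooth_family I V" and per: "\<And>E. E \<in> I \<Longrightarrow> one_periodic (V E)"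
    and E: "E \<in> I"
  shows "(dE (dT V) E has_integral 0) {0..1}"
    and "(dE (dE (dT V)) E has_integral 0) {0..1}"
proof -
  have 1: "dE (dT V) x = dT (dE V) x" if "x \<in> I" for x
    using dE_dT_commute[OF I V that] by blast
  show "(dE (dT V) E has_integral 0) {0..1}"
    unfolding 1[OF E]
    using dT_has_derivative[OF smooth_family_dE[OF V] E] one_periodic_dE[OF I V E per]
    by (rule periodic_derivative_has_integral)
  \<comment> \<open>The commutation relation holds on all of \<open>I\<close> and may therefore be
    differentiated in E once more; a second commutation then brings \<open>dT\<close> to the
    outside.\<close>
  have "dE (dE (dT V)) E t = dE (dT (dE V)) E t" for t
    using 1 by (intro dE_eqI[OF I _ E _ dE_has_derivative[OF _ E]]) (auto intro!: smooth_family_intros V)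
  also have "\<dots> t = dT (dE (dE V)) E t" for t
    using dE_dT_commute[OF I smooth_family_dE[OF V] E] by blast
  finally have 2: "dE (dE (dT V)) E = dT (dE (dE V)) E" by blast
  show "(dE (dE (dT V)) E has_integral 0) {0..1}"
    unfolding 2
    using dT_has_derivative[OF smooth_family_dE[OF smooth_family_dE[OF V]] E]
      one_periodic_dE[OF I smooth_family_dE[OF V] E one_periodic_dE[OF I V _ per]]
    by (rule periodic_derivative_has_integral)
qed

text \<open>A cubic error bound by itself says nothing about derivatives. For the remainder
  \<open>g\<close> it gives g / x -> 0 and g / x^2 -> 0; the first limit is the derivative of
  \<open>g\<close> at 0, and l'Hopital's rule turns the second into half its second
  derivative.\<close>

lemma taylor_coefficients_unique:
  fixes f :: "real \<Rightarrow> real"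
  assumes U: "open U" "0 \<in> U"
    and f: "\<And>x. x \<in> U \<Longrightarrow> (f has_real_derivative f' x) (at x)"
    and f': "\<And>x. x \<in> U \<Longrightarrow> (f' has_real_derivative f'' x) (at x)"
    and bigo: "(\<lambda>x. f x - (f 0 + x * a + x\<^sup>2 * b)) \<in> O[at 0](\<lambda>x. x ^ 3)"
  shows "f' 0 = a" "f'' 0 = 2 * b"
proof -
  define g where "g x = f x - (f 0 + x * a + x\<^sup>2 * b)" for x
  define g' where "g' x = f' x - (a + 2 * x * b)" for x
  have g: "(g has_real_derivative g' x) (at x)" if "x \<in> U" for x
    unfolding g_def g'_def by (rule derivative_eq_intros f that refl)+ simp
  have g'': "(g' has_real_derivative f'' 0 - 2 * b) (at 0)"
    unfolding g'_def by (rule derivative_eq_intros f' U refl)+ simp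
  have small: "((\<lambda>x. g x / x ^ n) \<longlongrightarrow> 0) (at 0)" if "n \<le> 2" for n
  proof -
    have "(\<lambda>x::real. x ^ 3) \<in> o[at 0](\<lambda>x. x ^ n)"
    proof (rule smalloI_tendsto)
      have "((\<lambda>x::real. x ^ (3 - n)) \<longlongrightarrow> 0 ^ (3 - n)) (at 0)"
        by (intro tendsto_intros)
      moreover have "\<forall>\<^sub>F x::real in at 0. x ^ (3 - n) = x ^ 3 / x ^ n"
        using that by (auto simp: eventually_at_filter power_diff)
      ultimately show "((\<lambda>x::real. x ^ 3 / x ^ n) \<longlongrightarrow> 0) (at 0)"
        using that by (simp add: tendsto_cong power_0_left split: if_splits)
      show "\<forall>\<^sub>F x::real in at 0. x ^ n \<noteq> 0"
        by (rule eventually_mono[OF eventually_neq_at_within[of 0]]) simp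
    qed
    then show ?thesis
      using bigo landau_o.big_small_trans smalloD_tendsto unfolding g_def by blast
  qed
  have g0: "g 0 = 0" by (simp add: g_def)
  have "((\<lambda>x. g x / x) \<longlongrightarrow> g' 0) (at 0)"
    using g[OF U(2)] by (simp add: has_field_derivative_iff g0)
  then have "g' 0 = 0"
    using small[of 1] tendsto_unique[OF _ _ small[of 1]] by force
  then show "f' 0 = a" by (simp add: g'_def)
  have "((\<lambda>x. g' x / x) \<longlongrightarrow> f'' 0 - 2 * b) (at 0)"
    using g'' \<open>g' 0 = 0\<close> by (simp add: has_field_derivative_iff)
  then have lim: "((\<lambda>x. g' x / (2 * x)) \<longlongrightarrow> (f'' 0 - 2 * b) / 2) (at 0)"
    using tendsto_divide[OF _ tendsto_const[of 2]] by (fastforce simp: mult.commute)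
  have "((\<lambda>x. g x / x\<^sup>2) \<longlongrightarrow> (f'' 0 - 2 * b) / 2) (at 0)"
  proof (rule lhopital[OF _ _ _ _ _ _ lim])
    show "(g \<longlongrightarrow> 0) (at 0)" using small[of 0] by simp
    show "((\<lambda>x::real. x\<^sup>2) \<longlongrightarrow> 0) (at 0)" by (rule tendsto_eq_intros refl | simp)+
    show "\<forall>\<^sub>F x in at 0. (g has_real_derivative g' x) (at x)"
      using eventually_nhds_in_open[OF U] g
      by (auto simp: eventually_at_filter elim!: eventually_mono)
    show "\<forall>\<^sub>F x::real in at 0. (power2 has_real_derivative 2 * x) (at x)"
      by (auto intro!: always_eventually derivative_eq_intros)
  qed (auto simp: eventually_at_filter)
  then have "(f'' 0 - 2 * b) / 2 = 0"
    using tendsto_unique[OF _ _ small[of 2]] by force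
  then show "f'' 0 = 2 * b" by simp
qed

section \<open>Laplace eigenvalues\<close>

lemma smooth_on_real_derivatives:
  fixes f :: "real \<Rightarrow> real"
  assumes "open I" "smooth_on I f" "E \<in> I"
  shows "(f has_real_derivative deriv f E) (at E)"
    and "(deriv f has_real_derivative deriv (deriv f) E) (at E)"
proof -
  have eq: "frechet_derivative g (at x) 1 = deriv g x" "(g has_real_derivative deriv g x) (at x)"
    if "smooth_on I g" "x \<in> I" for g :: "real \<Rightarrow> real" and x
  proof -
    have D: "(g has_derivative frechet_derivative g (at x)) (at x)"
      using smooth_on_has_derivative that by blast
    have "frechet_derivative g (at x) d = d * frechet_derivative g (at x) 1" for d
      using linear_scale[OF has_derivative_linear[OF D], of d 1] by simp
    then have "(g has_real_derivative frechet_derivative g (at x) 1) (at x)"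
      using D by (metis (no_types, lifting) ext has_field_derivative_def mult_commute_abs)
    then show "frechet_derivative g (at x) 1 = deriv g x" "(g has_real_derivative deriv g x) (at x)"
      using DERIV_imp_deriv by force+
  qed
  have "smooth_on I (deriv f)"
    using smooth_on_frechet_derivative[OF assms(2), of 1] unfolding smooth_on_def
    by (intro allI C_k_on_cong[OF assms(1) eq(1)[OF assms(2)]]) auto
  then show "(f has_real_derivative deriv f E) (at E)"
    "(deriv f has_real_derivative deriv (deriv f) E) (at E)"
    using eq assms by blast+
qed

section \<open>Periodic solutions and their ambiguity\<close>

lemma periodic_solution_has_derivatives:
  assumes "periodic_solution F C"
  obtains C' where "\<And>t. (C has_real_derivative C' t) (at t)"
    "\<And>t. (C' has_real_derivative F t (C t)) (at t)" "one_periodic C" "one_periodic C'"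
  using assms one_periodic_derivative unfolding periodic_solution_def by metis

lemma periodic_solution_continuous: "periodic_solution F C \<Longrightarrow> continuous_on S C"
  unfolding periodic_solution_def by (meson DERIV_isCont continuous_at_imp_continuous_on)

text \<open>Isolates the freedom in the choice of \<open>C\<close>: a statement about all admissible
  \<open>C\<close> reduces to the one supplied by the eigenfunction plus a homogeneous periodic
  solution.\<close>

lemma periodic_solution_diff:
  assumes "periodic_solution (\<lambda>t x. f t - k * x) C" "periodic_solution (\<lambda>t x. f t - k * x) D"
  shows "periodic_solution (\<lambda>t x. - (k * x)) (\<lambda>t. C t - D t)"
proof -
  obtain C' where C: "\<And>t. (C has_real_derivative C' t) (at t)"
    "\<And>t. (C' has_real_derivative f t - k * C t) (at t)" "one_periodic C"
    using periodic_solution_has_derivatives[OF assms(1)] by metis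
  obtain D' where D: "\<And>t. (D has_real_derivative D' t) (at t)"
    "\<And>t. (D' has_real_derivative f t - k * D t) (at t)" "one_periodic D"
    using periodic_solution_has_derivatives[OF assms(2)] by metis
  show ?thesis
    unfolding periodic_solution_def
  proof (intro conjI exI[of _ "\<lambda>t. C' t - D' t"] allI)
    show "one_periodic (\<lambda>t. C t - D t)" using C D by (simp add: one_periodic_def)
    show "((\<lambda>t. C t - D t) has_real_derivative C' t - D' t) (at t)" for t
      by (intro DERIV_diff C D)
    show "((\<lambda>t. C' t - D' t) has_real_derivative - (k * (C t - D t))) (at t)" for t
      using DERIV_diff[OF C(2) D(2), of t] by (simp add: algebra_simps)
  qed
qed

text \<open>Periodicity removes the slope of an affine function; hence \<open>C\<close> in (c) and
  (e) is unique up to an additive constant.\<close>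

lemma periodic_affine_constant:
  fixes f :: "real \<Rightarrow> real"
  assumes "periodic_solution (\<lambda>t x. 0) f"
  shows "\<exists>c. \<forall>t. f t = c"
proof -
  obtain f' where f: "\<And>t. (f has_real_derivative f' t) (at t)"
    "\<And>t. (f' has_real_derivative 0) (at t)" "one_periodic f"
    using periodic_solution_has_derivatives[OF assms] by metis
  obtain m where m: "f' t = m" for t
    using has_field_derivative_zero_constant[OF convex_UNIV f(2)] by blast
  have "((\<lambda>t. f t - m * t) has_real_derivative 0) (at t)" for t
    by (rule derivative_eq_intros f refl)+ (simp add: m)
  then obtain c where c: "f t - m * t = c" for t
    using has_field_derivative_zero_constant[of UNIV "\<lambda>t. f t - m * t"] by auto
  have "f 1 = f 0" using f(3) unfolding one_periodic_def by (metis add_0)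
  then have "m = 0" using c[of 0] c[of 1] by simp
  then show ?thesis using c by auto
qed

lemma harmonic_oscillator_solution:
  fixes w :: real
  assumes w: "w \<noteq> 0" and f: "\<And>t. (f has_real_derivative f' t) (at t)"
    "\<And>t. (f' has_real_derivative - (w\<^sup>2 * f t)) (at t)"
  shows "\<exists>a b. \<forall>t. f t = a * cos (w * t) + b * sin (w * t)"
proof -
  \<comment> \<open>The phase-space vector \<open>(f, f' / w)\<close> turns with angular velocity
    \<open>w\<close>; \<open>p\<close> and \<open>q\<close> are its coordinates after turning it
    back, hence the two amplitudes.\<close>
  define p where "p t = f t * cos (w * t) - f' t / w * sin (w * t)" for t
  define q where "q t = f t * sin (w * t) + f' t / w * cos (w * t)" for t
  have "(p has_real_derivative 0) (at t)" for t
    unfolding p_def using w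
    by (auto intro!: derivative_eq_intros f simp: field_simps power2_eq_square)
  then obtain a where a: "p t = a" for t
    using has_field_derivative_zero_constant[of UNIV p] by auto
  have "(q has_real_derivative 0) (at t)" for t
    unfolding q_def using w
    by (auto intro!: derivative_eq_intros f simp: field_simps power2_eq_square)
  then obtain b where b: "q t = b" for t
    using has_field_derivative_zero_constant[of UNIV q] by auto
  have "f t = p t * cos (w * t) + q t * sin (w * t)" for t
  proof -
    have "p t * cos (w * t) + q t * sin (w * t) = f t * ((sin (w * t))\<^sup>2 + (cos (w * t))\<^sup>2)"
      unfolding p_def q_def
      by (simp add: algebra_simps power2_eq_square del: sin_cos_squared_add3 sin_cos_squared_add
          sin_cos_squared_add2)
    then show ?thesis by simp
  qed
  then show ?thesis using a b by auto
qed

lemma eigenspace_family: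
  assumes I: "open I" and A: "smooth_family I A" and E: "E \<in> I" and eig: "A E \<in> eigenspace q"
  shows "one_periodic (A E)" "dT (dT A) E t = - (q t * A E t)"
    "(dT A E has_real_derivative - (q t * A E t)) (at t)"
proof -
  obtain A' where A': "\<And>t. (A E has_real_derivative A' t) (at t)"
    "\<And>t. (A' has_real_derivative - (q t * A E t)) (at t)" "one_periodic (A E)"
    using periodic_solution_has_derivatives[OF eig[unfolded eigenspace_def mem_Collect_eq]] by metis
  have "dT A E = A'"
    using A'(1) dT_has_derivative[OF A E] DERIV_unique by blast
  then show "one_periodic (A E)" "(dT A E has_real_derivative - (q t * A E t)) (at t)"
    "dT (dT A) E t = - (q t * A E t)"
    using A' dT_has_derivative[OF smooth_family_dT[OF A] E] DERIV_unique by metis+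
qed

text \<open>\<open>V\<close> is the Wronskian of \<open>A E\<close> and \<open>A 0\<close>. In its
  t-derivative the second derivatives combine to the factor \<open>Q E t - Q 0 t\<close>, which
  vanishes at E = 0; hence two differentiations in E bring in only the first variation of the
  eigenfunction. The equation for that variation is the E-derivative of the eigenvalue
  equation.\<close>

lemma second_variation:
  assumes I: "open I" "0 \<in> I" and A: "smooth_family I A" and Q: "smooth_family I Q"
    and eig: "\<And>E. E \<in> I \<Longrightarrow> A E \<in> eigenspace (Q E)"
  shows "((\<lambda>t. dE Q 0 t * (A 0 t)\<^sup>2) has_integral 0) {0..1}"
    and "((\<lambda>t. 2 * dE Q 0 t * dE A 0 t * A 0 t + dE (dE Q) 0 t * (A 0 t)\<^sup>2) has_integral 0) {0..1}"
    and "periodic_solution (\<lambda>t x. - (dE Q 0 t * A 0 t) - Q 0 t * x) (dE A 0)"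
proof -
  note [simp] = I
  note eig_fam = eigenspace_family[OF I(1) A _ eig]
  define V where "V E t = dT A E t * A 0 t - A E t * dT A 0 t" for E t
  have V: "smooth_family I V"
    unfolding V_def by (intro smooth_family_intros A I)
  have V_per: "one_periodic (V E)" if "E \<in> I" for E
    using eig_fam(1) one_periodic_dT[OF A] that I(2) by (simp add: V_def one_periodic_def)
  have dTV: "dT V E t = - ((Q E t - Q 0 t) * A E t * A 0 t)" if "E \<in> I" for E t
  proof (rule DERIV_unique[OF dT_has_derivative[OF V that]])
    show "(V E has_real_derivative - ((Q E t - Q 0 t) * A E t * A 0 t)) (at t)"
      unfolding V_def[abs_def] using that
      by (auto intro!: derivative_eq_intros dT_has_derivative[OF A] eig_fam(3) simp: algebra_simps)
  qed
  have d1: "dE (dT V) E t = - ((dE Q E t * A E t + (Q E t - Q 0 t) * dE A E t) * A 0 t)"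
    if "E \<in> I" for E t
    by (rule dE_eqI[where F="dT V" and t=t, OF I(1) _ that dTV])
      (use that in \<open>auto intro!: derivative_eq_intros smooth_family_dT V dE_has_derivative[OF A]
          dE_has_derivative[OF Q] simp: algebra_simps\<close>)
  have d2: "dE (dE (dT V)) 0 t = - ((dE (dE Q) 0 t * A 0 t + 2 * dE Q 0 t * dE A 0 t) * A 0 t)" for t
    by (rule dE_eqI[where F="dE (dT V)" and t=t, OF I(1) _ I(2) d1])
      (auto intro!: derivative_eq_intros smooth_family_dT smooth_family_dE V dE_has_derivative[OF A]
          dE_has_derivative[OF Q] dE_has_derivative[OF smooth_family_dE[OF A]]
          dE_has_derivative[OF smooth_family_dE[OF Q]] simp: algebra_simps)
  have "dE (dT V) 0 = (\<lambda>t. - (dE Q 0 t * (A 0 t)\<^sup>2))"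
    by (rule ext) (simp add: d1 power2_eq_square algebra_simps)
  then show "((\<lambda>t. dE Q 0 t * (A 0 t)\<^sup>2) has_integral 0) {0..1}"
    using periodic_family_solvability(1)[OF I(1) V V_per I(2)] by (simp only: has_integral_neg_iff minus_zero)
  have "dE (dE (dT V)) 0 = (\<lambda>t. - (2 * dE Q 0 t * dE A 0 t * A 0 t + dE (dE Q) 0 t * (A 0 t)\<^sup>2))"
    by (rule ext) (simp add: d2 power2_eq_square algebra_simps)
  then show "((\<lambda>t. 2 * dE Q 0 t * dE A 0 t * A 0 t + dE (dE Q) 0 t * (A 0 t)\<^sup>2) has_integral 0) {0..1}"
    using periodic_family_solvability(2)[OF I(1) V V_per I(2)] by (simp only: has_integral_neg_iff minus_zero)
  have "dT (dE A) 0 = dE (dT A) 0"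
    using dE_dT_commute[OF I(1) A I(2)] by auto
  moreover have "dT (dE (dT A)) 0 t = - (dE Q 0 t * A 0 t) - Q 0 t * dE A 0 t" for t
  proof -
    have "dE (dT (dT A)) 0 t = - (dE Q 0 t * A 0 t) - Q 0 t * dE A 0 t"
      by (rule dE_eqI[where F="dT (dT A)" and t=t, OF I(1) _ I(2) eig_fam(2)])
        (auto intro!: derivative_eq_intros smooth_family_dT A dE_has_derivative[OF A]
          dE_has_derivative[OF Q] simp: algebra_simps)
    then show ?thesis
      using dE_dT_commute[OF I(1) smooth_family_dT[OF A] I(2)] by simp
  qed
  ultimately have "(dT (dE A) 0 has_real_derivative - (dE Q 0 t * A 0 t) - Q 0 t * dE A 0 t) (at t)" for t
    using dT_has_derivative[OF smooth_family_dE[OF smooth_family_dT[OF A]] I(2), of t] by simp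
  then show "periodic_solution (\<lambda>t x. - (dE Q 0 t * A 0 t) - Q 0 t * x) (dE A 0)"
    unfolding periodic_solution_def
    using one_periodic_dE[OF I(1) A I(2) eig_fam(1)] dT_has_derivative[OF smooth_family_dE[OF A] I(2)]
    by blast
qed

text \<open>Treats (a), (b) and (c) together, with \<open>c\<close> the term from the y-frequency
  and \<open>N\<close> the squared norm of \<open>a\<close>; the value N = 1 / 2 for sin and cos
  produces the factor 16 in place of 8. The formulas for \<open>H\<close> and \<open>G\<close> make
  them the Taylor coefficients of \<open>r^2\<close>, and \<open>degenerate\<close> is what makes
  the result independent of the choice of \<open>C\<close>.\<close>

lemma laplace_second_variation:
  assumes I: "open I" "0 \<in> I" and r: "smooth_family I r" "\<And>t. r 0 t = 1"
    and H: "\<And>t. H t = 2 * dE r 0 t" and G: "\<And>t. G t = dE (dE r) 0 t + (dE r 0 t)\<^sup>2"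
    and spec: "spectral_function I (\<lambda>E m t. m * (r E t)\<^sup>2 - c) \<mu> a"
    and a: "((\<lambda>t. (a t)\<^sup>2) has_integral N) {0..1}" "N \<noteq> 0"
    and H_int: "integral {0..1} (\<lambda>t. H t * (a t)\<^sup>2) = 0"
    and degenerate: "\<And>D. periodic_solution (\<lambda>t x. - ((4 * pi\<^sup>2 - c) * x)) D \<Longrightarrow>
      integral {0..1} (\<lambda>t. H t * D t * a t) = 0"
  defines "S \<equiv> periodic_solution (\<lambda>t x. - 4 * pi\<^sup>2 * H t * a t - (4 * pi\<^sup>2 - c) * x)"
  shows "(\<exists>C. S C) \<and> (\<forall>C. S C \<longrightarrow> deriv (deriv \<mu>) 0 * N =
    - 8 * pi\<^sup>2 * integral {0..1} (\<lambda>t. G t * (a t)\<^sup>2) - 8 * pi\<^sup>2 * integral {0..1} (\<lambda>t. H t * C t * a t))"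
proof -
  obtain A where mu: "smooth_on I \<mu>" "\<mu> 0 = 4 * pi\<^sup>2" and A: "smooth_family I A" "A 0 = a"
    and eig: "\<And>E. E \<in> I \<Longrightarrow> A E \<in> eigenspace (\<lambda>t. \<mu> E * (r E t)\<^sup>2 - c)"
    using spec unfolding spectral_function_def smooth_family_def by auto
  define Q where "Q E t = \<mu> E * (r E t)\<^sup>2 - c" for E t
  have Q: "smooth_family I Q"
    unfolding Q_def by (intro smooth_family_intros r mu I)
  note dmu = smooth_on_real_derivatives[OF I(1) mu(1)]
  have dQ: "dE Q E t = deriv \<mu> E * (r E t)\<^sup>2 + \<mu> E * (2 * r E t * dE r E t)" if "E \<in> I" for E t
    by (rule dE_eqI[where t=t, OF I(1) Q that Q_def])
      (use that in \<open>auto intro!: derivative_eq_intros dmu dE_has_derivative[OF r(1)]\<close>)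
  \<comment> \<open>The second E-derivative of \<open>r^2\<close> at 0 is \<open>2 * G t\<close>,
    which doubles the factor \<open>4 * pi^2\<close> coming from \<open>\<mu> 0\<close>.\<close>
  have ddQ: "dE (dE Q) 0 t = deriv (deriv \<mu>) 0 + 2 * deriv \<mu> 0 * H t + 8 * pi\<^sup>2 * G t" for t
    by (rule dE_eqI[where t=t, OF I(1) smooth_family_dE[OF Q] I(2) dQ])
      (use I mu in \<open>auto intro!: derivative_eq_intros dmu dE_has_derivative[OF r(1)]
        dE_has_derivative[OF smooth_family_dE[OF r(1)]] simp: r H G power2_eq_square algebra_simps\<close>)
  have dQ0: "dE Q 0 t = deriv \<mu> 0 + 4 * pi\<^sup>2 * H t" for t
    by (simp add: dQ I r mu H)
  have eigQ: "A E \<in> eigenspace (Q E)" if "E \<in> I" for E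
    using eig[OF that] by (simp add: Q_def[abs_def])
  note var = second_variation[OF I A(1) Q eigQ, unfolded A(2) ddQ dQ0]
  have cont: "continuous_on {0..1} a" "continuous_on {0..1} H" "continuous_on {0..1} G"
    using smooth_family_continuous_t[OF A(1) I(2)] smooth_family_continuous_t[OF smooth_family_dE[OF r(1)] I(2)]
      smooth_family_continuous_t[OF smooth_family_dE[OF smooth_family_dE[OF r(1)]] I(2)]
    by (auto simp: A(2) H[abs_def] G[abs_def] intro!: continuous_intros)
  have int: "f integrable_on {0..1}" if "continuous_on {0..1} f" for f :: "real \<Rightarrow> real"
    using that by (rule integrable_continuous_real)
  have 1: "((\<lambda>t. deriv \<mu> 0 * (a t)\<^sup>2 + 4 * pi\<^sup>2 * (H t * (a t)\<^sup>2)) has_integral deriv \<mu> 0 * N + 4 * pi\<^sup>2 * 0) {0..1}"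
    by (rule has_integral_add[OF has_integral_mult_right[OF a(1)] has_integral_mult_right])
      (use H_int in \<open>auto intro!: int continuous_intros cont simp: has_integral_iff\<close>)
  have 2: "((\<lambda>t. deriv \<mu> 0 * (a t)\<^sup>2 + 4 * pi\<^sup>2 * (H t * (a t)\<^sup>2)) has_integral 0) {0..1}"
    using var(1) by (simp add: algebra_simps)
  have mu1: "deriv \<mu> 0 = 0"
    using has_integral_unique[OF 1 2] a(2) by simp
  have SA: "S (dE A 0)"
    unfolding S_def by (rule subst[of _ _ "\<lambda>F. periodic_solution F (dE A 0)", OF _ var(3)])
      (simp add: fun_eq_iff Q_def mu1 r(2) mu(2))
  have "deriv (deriv \<mu>) 0 * N =
    - 8 * pi\<^sup>2 * integral {0..1} (\<lambda>t. G t * (a t)\<^sup>2) - 8 * pi\<^sup>2 * integral {0..1} (\<lambda>t. H t * C t * a t)"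
    if "S C" for C
  proof -
    have contC: "continuous_on {0..1} C"
      using that unfolding S_def by (rule periodic_solution_continuous)
    have contA: "continuous_on {0..1} (dE A 0)"
      using smooth_family_continuous_t[OF smooth_family_dE[OF A(1)] I(2)] .
    have "integral {0..1} (\<lambda>t. H t * (C t - dE A 0 t) * a t) = 0"
      by (rule degenerate[OF periodic_solution_diff[OF that[unfolded S_def] SA[unfolded S_def]]])
    \<comment> \<open>Together with the preceding vanishing integral, linearity lets an arbitrary
      \<open>C\<close> take the place of the first variation of the eigenfunction.\<close>
    moreover have "integral {0..1} (\<lambda>t. H t * (C t - dE A 0 t) * a t) =
      integral {0..1} (\<lambda>t. H t * C t * a t) - integral {0..1} (\<lambda>t. H t * dE A 0 t * a t)"
      using integral_diff[of "\<lambda>t. H t * C t * a t" "{0..1}" "\<lambda>t. H t * dE A 0 t * a t"]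
      by (simp add: int continuous_intros cont contA contC right_diff_distrib left_diff_distrib)
    ultimately have HC: "integral {0..1} (\<lambda>t. H t * dE A 0 t * a t) = integral {0..1} (\<lambda>t. H t * C t * a t)"
      by simp
    have 1: "((\<lambda>t. deriv (deriv \<mu>) 0 * (a t)\<^sup>2 + 8 * pi\<^sup>2 * (G t * (a t)\<^sup>2) + 8 * pi\<^sup>2 * (H t * dE A 0 t * a t))
      has_integral deriv (deriv \<mu>) 0 * N + 8 * pi\<^sup>2 * integral {0..1} (\<lambda>t. G t * (a t)\<^sup>2)
        + 8 * pi\<^sup>2 * integral {0..1} (\<lambda>t. H t * dE A 0 t * a t)) {0..1}"
      by (rule has_integral_add[OF has_integral_add[OF has_integral_mult_right[OF a(1)]
            has_integral_mult_right] has_integral_mult_right];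
          rule integrable_integral; rule int; intro continuous_intros cont contA)
    have 2: "((\<lambda>t. deriv (deriv \<mu>) 0 * (a t)\<^sup>2 + 8 * pi\<^sup>2 * (G t * (a t)\<^sup>2)
      + 8 * pi\<^sup>2 * (H t * dE A 0 t * a t)) has_integral 0) {0..1}"
      using var(2) by (simp add: mu1 algebra_simps)
    show ?thesis
      using has_integral_unique[OF 1 2] HC by simp
  qed
  then show ?thesis using SA by blast
qed

section \<open>Dirac eigenvalues\<close>

text \<open>Trades the second-order equation, whose coefficient involves \<open>f'\<close> and
  \<open>f''\<close>, for a system in which only \<open>f^2\<close> occurs. Its variation in E can
  then be computed without differentiating the metric in t.\<close>

lemma dirac_first_order_system:
  assumes f: "\<And>t. (f has_real_derivative f' t) (at t)" "\<And>t. (f' has_real_derivative f'' t) (at t)"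
    and pos: "\<And>t. 0 < f t"
    and A: "\<And>t. (A has_real_derivative A' t) (at t)"
      "\<And>t. (A' has_real_derivative - (dirac_coeff l f \<nu> t * A t)) (at t)"
  defines "k \<equiv> 2 * pi * of_int l"
  defines "u \<equiv> \<lambda>t. f t * A t" and "w \<equiv> \<lambda>t. (f' t * A t + f t * A' t - k * (f t * A t)) / (f t)\<^sup>2"
  shows "(u has_real_derivative k * u t + (f t)\<^sup>2 * w t) (at t)"
    and "(w has_real_derivative - (k * w t) - \<nu> * (f t)\<^sup>2 * u t) (at t)"
proof -
  have nz: "f t \<noteq> 0" for t using pos[of t] by simp
  have "deriv f = f'" "deriv f' = f''"
    using f by (auto intro!: DERIV_imp_deriv)
  then have q: "dirac_coeff l f \<nu> t = \<nu> * f t ^ 4 + (f t * f'' t - 2 * (f' t)\<^sup>2) / (f t)\<^sup>2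
      - k\<^sup>2 + 2 * k * (f' t / f t)"
    by (simp add: dirac_coeff_def k_def power2_eq_square)
  have "(u has_real_derivative f' t * A t + A' t * f t) (at t)"
    unfolding u_def by (intro DERIV_mult f A)
  also have "f' t * A t + A' t * f t = k * u t + (f t)\<^sup>2 * w t"
    using nz[of t] by (simp add: u_def w_def)
  finally show "(u has_real_derivative k * u t + (f t)\<^sup>2 * w t) (at t)" .
  have "(w has_real_derivative
      ((f'' t * A t + A' t * f' t + (f' t * A' t + - (dirac_coeff l f \<nu> t * A t) * f t)
        - k * (f' t * A t + A' t * f t)) * (f t)\<^sup>2
       - (f' t * A t + f t * A' t - k * (f t * A t)) * (2 * f t * f' t)) / ((f t)\<^sup>2 * (f t)\<^sup>2)) (at t)"
    (is "(w has_real_derivative ?d) _")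
    unfolding w_def
    by (intro DERIV_divide DERIV_diff DERIV_add DERIV_mult DERIV_cmult f A)
      (use nz in \<open>auto intro!: derivative_eq_intros f\<close>)
  \<comment> \<open>The \<open>f''\<close> from the numerator cancels the one in the Dirac
    coefficient, and the terms with \<open>f'\<close> squared cancel those of the quotient rule;
    what remains regroups into \<open>- k * w\<close>.\<close>
  also have "?d = - (k * w t) - \<nu> * (f t)\<^sup>2 * u t"
    using nz[of t] unfolding q u_def w_def by (simp add: field_simps power2_eq_square power4_eq_xxxx)
  finally show "(w has_real_derivative - (k * w t) - \<nu> * (f t)\<^sup>2 * u t) (at t)" .
qed

definition first_order_system ::
    "real set \<Rightarrow> real \<Rightarrow> (real \<Rightarrow> real \<Rightarrow> real) \<Rightarrow> (real \<Rightarrow> real) \<Rightarrow>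
      (real \<Rightarrow> real \<Rightarrow> real) \<Rightarrow> (real \<Rightarrow> real \<Rightarrow> real) \<Rightarrow> bool" where
  "first_order_system I k r \<nu> u w \<longleftrightarrow> smooth_family I u \<and> smooth_family I w \<and>
    (\<forall>E\<in>I. one_periodic (u E) \<and> one_periodic (w E) \<and>
      (\<forall>t. (u E has_real_derivative k * u E t + r E t * w E t) (at t) \<and>
           (w E has_real_derivative - (k * w E t) - \<nu> E * r E t * u E t) (at t)))"

lemma dirac_family_system:
  assumes I: "open I" and h: "smooth_family I h" "\<And>E. E \<in> I \<Longrightarrow> one_periodic (h E)"
      "\<And>E t. E \<in> I \<Longrightarrow> 0 < h E t"
    and A: "smooth_family I A"
    and eig: "\<And>E. E \<in> I \<Longrightarrow> A E \<in> eigenspace (dirac_coeff l (h E) (\<nu> E))"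
  shows "\<exists>w. first_order_system I (2 * pi * of_int l) (\<lambda>E t. (h E t)\<^sup>2) \<nu> (\<lambda>E t. h E t * A E t) w"
proof -
  define k :: real where "k = 2 * pi * of_int l"
  define u where "u E t = h E t * A E t" for E t
  define w where "w E t = (dT h E t * A E t + h E t * dT A E t - k * (h E t * A E t)) / (h E t)\<^sup>2" for E t
  note eig_fam = eigenspace_family[OF I A _ eig]
  have nz: "h E t \<noteq> 0" if "E \<in> I" for E t using h(3)[OF that, of t] by simp
  have smooth: "smooth_family I u" "smooth_family I w"
    unfolding u_def w_def using nz
    by (auto intro!: smooth_family_divide[OF I] smooth_family_intros A h I)
  have per: "one_periodic (u E)" "one_periodic (w E)" if E: "E \<in> I" for E
    using eig_fam(1)[OF E E] h(2)[OF E] one_periodic_dT[OF A E] one_periodic_dT[OF h(1) E]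
    by (auto simp: one_periodic_def u_def w_def)
  have deriv: "(u E has_real_derivative k * u E t + (h E t)\<^sup>2 * w E t) (at t)"
    "(w E has_real_derivative - (k * w E t) - \<nu> E * (h E t)\<^sup>2 * u E t) (at t)" if E: "E \<in> I" for E t
    unfolding u_def[abs_def] w_def[abs_def] k_def
    using dirac_first_order_system[OF dT_has_derivative[OF h(1) E]
        dT_has_derivative[OF smooth_family_dT[OF h(1)] E] h(3)[OF E] dT_has_derivative[OF A E] eig_fam(3)[OF E E]]
    by blast+
  have "first_order_system I k (\<lambda>E t. (h E t)\<^sup>2) \<nu> u w"
    unfolding first_order_system_def using smooth per deriv by blast
  then show ?thesis unfolding k_def u_def[abs_def] by blast
qed

lemma periodic_family_int_by_parts:
  assumes "\<And>t. (f has_real_derivative f' t) (at t)" "one_periodic f"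
    "\<And>t. (g has_real_derivative g' t) (at t)" "one_periodic g"
  shows "((\<lambda>t. f' t * g t + f t * g' t) has_integral 0) {0..1}"
  by (rule periodic_derivative_has_integral[where f="\<lambda>t. f t * g t"])
    (use assms in \<open>auto intro!: derivative_eq_intros simp: one_periodic_def\<close>)

text \<open>At E = 0 the solution is \<open>(1, - k)\<close>, and \<open>V = w + k * u\<close> is,
  up to sign, its symplectic pairing with \<open>(u, w)\<close>. The unperturbed system conserves
  \<open>V\<close> because \<open>k^2 = 4 * pi^2\<close>, so each term of \<open>dT V\<close>
  carries a factor \<open>r E t - 1\<close> or \<open>4 * pi^2 - \<nu> E * r E t\<close>, both zero
  at E = 0.\<close>

lemma first_order_second_variation:
  assumes I: "open I" "0 \<in> I" and r: "smooth_family I r" "\<And>t. r 0 t = 1"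
      "\<And>E. E \<in> I \<Longrightarrow> one_periodic (r E)"
    and \<nu>: "smooth_on I \<nu>" "\<nu> 0 = 4 * pi\<^sup>2"
    and sys: "first_order_system I k r \<nu> u w" and k: "k\<^sup>2 = 4 * pi\<^sup>2" and u_0: "\<And>t. u 0 t = 1"
    and H: "\<And>t. H t = 2 * dE r 0 t" and G: "\<And>t. G t = dE (dE r) 0 t + (dE r 0 t)\<^sup>2"
    and H_int: "(H has_integral 0) {0..1}"
  shows "periodic_solution (\<lambda>t x. - 4 * pi\<^sup>2 * H t - k / 2 * deriv H t) (dE u 0)"
    and "((\<lambda>t. - 8 * pi\<^sup>2 * G t + 4 * pi\<^sup>2 * (H t)\<^sup>2 - 8 * pi\<^sup>2 * (H t * dE u 0 t)
      - k * (deriv H t * dE u 0 t)) has_integral deriv (deriv \<nu>) 0) {0..1}"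
proof -
  note [simp] = I
  have u: "smooth_family I u" "\<And>t. u 0 t = 1" "\<And>E. E \<in> I \<Longrightarrow> one_periodic (u E)"
    and w: "smooth_family I w" "\<And>E. E \<in> I \<Longrightarrow> one_periodic (w E)"
    and du: "\<And>E t. E \<in> I \<Longrightarrow> (u E has_real_derivative k * u E t + r E t * w E t) (at t)"
    and dw: "\<And>E t. E \<in> I \<Longrightarrow> (w E has_real_derivative - (k * w E t) - \<nu> E * r E t * u E t) (at t)"
    using sys u_0 unfolding first_order_system_def by blast+
  note der = dE_has_derivative[OF r(1)] dE_has_derivative[OF u(1)] dE_has_derivative[OF w(1)]
    dE_has_derivative[OF smooth_family_dE[OF r(1)]] dE_has_derivative[OF smooth_family_dE[OF u(1)]]
    dE_has_derivative[OF smooth_family_dE[OF w(1)]] smooth_on_real_derivatives[OF I(1) \<nu>(1)]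
  have kk: "k * (k * x) = 4 * (pi\<^sup>2 * x)" for x
    using k by (simp add: power2_eq_square flip: mult.assoc)
  have w0: "w 0 t = - k" for t
  proof -
    have "u 0 = (\<lambda>t. 1)" using u(2) by auto
    then have "((\<lambda>t. 1) has_real_derivative k + w 0 t) (at t)"
      using du[OF I(2), of t] by (simp add: r(2))
    from DERIV_unique[OF this DERIV_const] show ?thesis by simp
  qed
  define V where "V E t = w E t + k * u E t" for E t
  have V: "smooth_family I V" unfolding V_def by (intro smooth_family_intros u w I)
  have V_per: "one_periodic (V E)" if "E \<in> I" for E
    using u(3)[OF that] w(2)[OF that] by (simp add: V_def one_periodic_def)
  have dTV: "dT V E t = k * (r E t - 1) * w E t + (4 * pi\<^sup>2 - \<nu> E * r E t) * u E t" if "E \<in> I" for E t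
  proof (rule DERIV_unique[OF dT_has_derivative[OF V that]])
    have "(V E has_real_derivative (- (k * w E t) - \<nu> E * r E t * u E t)
        + k * (k * u E t + r E t * w E t)) (at t)"
      unfolding V_def[abs_def] by (intro DERIV_add DERIV_cmult du dw that)
    then show "(V E has_real_derivative k * (r E t - 1) * w E t + (4 * pi\<^sup>2 - \<nu> E * r E t) * u E t) (at t)"
      by (simp add: algebra_simps kk)
  qed
  have d1: "dE (dT V) E t = k * dE r E t * w E t + k * (r E t - 1) * dE w E t
      - (deriv \<nu> E * r E t + \<nu> E * dE r E t) * u E t + (4 * pi\<^sup>2 - \<nu> E * r E t) * dE u E t"
    if "E \<in> I" for E t
    by (rule dE_eqI[where F="dT V" and t=t, OF I(1) smooth_family_dT[OF V] that dTV])
      (use that in \<open>auto intro!: derivative_eq_intros der simp: algebra_simps\<close>)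
  have d2: "dE (dE (dT V)) 0 t = k * (2 * dE r 0 t * dE w 0 t - k * dE (dE r) 0 t)
      - (deriv (deriv \<nu>) 0 + 2 * deriv \<nu> 0 * dE r 0 t + 4 * pi\<^sup>2 * dE (dE r) 0 t)
      - 2 * (deriv \<nu> 0 + 4 * pi\<^sup>2 * dE r 0 t) * dE u 0 t" for t
    by (rule dE_eqI[where F="dE (dT V)" and t=t, OF I(1) smooth_family_dE[OF smooth_family_dT[OF V]] I(2) d1])
      (auto intro!: derivative_eq_intros der simp: r(2) u(2) w0 \<nu>(2) algebra_simps)
  have "dE (dT V) 0 = (\<lambda>t. - 4 * pi\<^sup>2 * H t - deriv \<nu> 0)"
    by (rule ext) (simp add: d1 r(2) u(2) w0 \<nu>(2) H algebra_simps kk)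
  then have "((\<lambda>t. - 4 * pi\<^sup>2 * H t - deriv \<nu> 0) has_integral 0) {0..1}"
    using periodic_family_solvability(1)[OF I(1) V V_per I(2)] by simp
  note 1 = this
  have 2: "((\<lambda>t. - 4 * pi\<^sup>2 * H t - deriv \<nu> 0) has_integral - 4 * pi\<^sup>2 * 0 - deriv \<nu> 0) {0..1}"
    using has_integral_const_real[of "deriv \<nu> 0" 0 1]
    by (intro has_integral_diff has_integral_mult_right H_int) simp
  have nu1: "deriv \<nu> 0 = 0"
    using has_integral_unique[OF 1 2] by simp
  have dTu: "dT u E t = k * u E t + r E t * w E t" and dTw: "dT w E t = - (k * w E t) - \<nu> E * r E t * u E t"
    if "E \<in> I" for E t
    using DERIV_unique[OF dT_has_derivative[OF u(1) that] du[OF that]]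
      DERIV_unique[OF dT_has_derivative[OF w(1) that] dw[OF that]] by auto
  have u1: "dT (dE u) 0 t = k * dE u 0 t + dE w 0 t - k / 2 * H t" for t
  proof -
    have "dE (dT u) 0 t = k * dE u 0 t + dE w 0 t - k / 2 * H t"
      by (rule dE_eqI[where F="dT u" and t=t, OF I(1) smooth_family_dT[OF u(1)] I(2) dTu])
        (auto intro!: derivative_eq_intros der simp: r(2) w0 H)
    then show ?thesis using dE_dT_commute[OF I(1) u(1) I(2)] by simp
  qed
  have w1: "dT (dE w) 0 t = - (k * dE w 0 t) - 2 * pi\<^sup>2 * H t - 4 * pi\<^sup>2 * dE u 0 t" for t
  proof -
    have "dE (dT w) 0 t = - (k * dE w 0 t) - 2 * pi\<^sup>2 * H t - 4 * pi\<^sup>2 * dE u 0 t"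
      by (rule dE_eqI[where F="dT w" and t=t, OF I(1) smooth_family_dT[OF w(1)] I(2) dTw])
        (auto intro!: derivative_eq_intros der simp: r(2) u(2) H nu1 \<nu>(2))
    then show ?thesis using dE_dT_commute[OF I(1) w(1) I(2)] by simp
  qed
  have H': "(H has_real_derivative deriv H t) (at t)" for t
  proof -
    have "(H has_real_derivative 2 * dT (dE r) 0 t) (at t)"
      unfolding H[abs_def] by (intro DERIV_cmult dT_has_derivative[OF smooth_family_dE[OF r(1)] I(2)])
    from this DERIV_imp_deriv[OF this] show ?thesis by simp
  qed
  have du1: "(dE u 0 has_real_derivative dT (dE u) 0 t) (at t)" for t
    by (rule dT_has_derivative[OF smooth_family_dE[OF u(1)] I(2)])
  have "(dT (dE u) 0 has_real_derivative k * dT (dE u) 0 t + dT (dE w) 0 t - k / 2 * deriv H t) (at t)" for t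
  proof -
    have "((\<lambda>t. k * dE u 0 t + dE w 0 t - k / 2 * H t) has_real_derivative
        k * dT (dE u) 0 t + dT (dE w) 0 t - k / 2 * deriv H t) (at t)"
      by (intro DERIV_add DERIV_diff DERIV_cmult H' du1 dT_has_derivative[OF smooth_family_dE[OF w(1)] I(2)])
    then show ?thesis unfolding u1[symmetric] .
  qed
  \<comment> \<open>All terms in \<open>dE u\<close> and \<open>dE w\<close> cancel since
    \<open>k^2 = 4 * pi^2\<close>; this is why \<open>C\<close> itself does not appear on the
    right-hand side of its equation in (e).\<close>
  moreover have "k * dT (dE u) 0 t + dT (dE w) 0 t - k / 2 * deriv H t = - 4 * pi\<^sup>2 * H t - k / 2 * deriv H t" for t
    unfolding u1 w1 by (simp add: algebra_simps power2_eq_square[of "dE _ _ _"] kk)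
  ultimately show "periodic_solution (\<lambda>t x. - 4 * pi\<^sup>2 * H t - k / 2 * deriv H t) (dE u 0)"
    unfolding periodic_solution_def
    using du1 one_periodic_dE[OF I(1) u(1) I(2) u(3)] by (intro conjI exI[of _ "dT (dE u) 0"]) auto
  have H_per: "one_periodic H"
    using one_periodic_dE[OF I(1) r(1) I(2) r(3)] by (simp add: one_periodic_def H)
  have parts: "((\<lambda>t. deriv H t * dE u 0 t + H t * dT (dE u) 0 t) has_integral 0) {0..1}"
    by (rule periodic_family_int_by_parts[OF H' H_per du1 one_periodic_dE[OF I(1) u(1) I(2) u(3)]])
  have const: "((\<lambda>t. deriv (deriv \<nu>) 0) has_integral deriv (deriv \<nu>) 0) {0..1::real}"
    using has_integral_const_real[of "deriv (deriv \<nu>) 0" 0 1] by simp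
  \<comment> \<open>Eliminating \<open>dE w\<close> by the variation of the first equation creates a
    term \<open>H * dT (dE u)\<close>. Subtracting \<open>k\<close> times the integration by parts
    trades it for \<open>deriv H * dE u\<close>.\<close>
  have "((\<lambda>t. dE (dE (dT V)) 0 t + deriv (deriv \<nu>) 0
      - k * (deriv H t * dE u 0 t + H t * dT (dE u) 0 t)) has_integral deriv (deriv \<nu>) 0) {0..1}"
    using has_integral_diff[OF has_integral_add[OF periodic_family_solvability(2)[OF I(1) V V_per I(2)] const]
        has_integral_mult_right[OF parts, of k]] by simp
  then show "((\<lambda>t. - 8 * pi\<^sup>2 * G t + 4 * pi\<^sup>2 * (H t)\<^sup>2 - 8 * pi\<^sup>2 * (H t * dE u 0 t)
      - k * (deriv H t * dE u 0 t)) has_integral deriv (deriv \<nu>) 0) {0..1}"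
  proof (rule has_integral_eq[rotated])
    fix t
    \<comment> \<open>Of the coefficient \<open>4 * pi^2\<close> of \<open>H^2\<close>, one half
      comes from the last term here (as \<open>k^2 / 2 = 2 * pi^2\<close>), the other from writing
      \<open>dE (dE r)\<close> as \<open>G - H^2 / 4\<close>.\<close>
    have w1: "dE w 0 t = dT (dE u) 0 t - k * dE u 0 t + k * dE r 0 t"
      using u1[of t] by (simp add: H)
    show "dE (dE (dT V)) 0 t + deriv (deriv \<nu>) 0 - k * (deriv H t * dE u 0 t + H t * dT (dE u) 0 t)
      = - 8 * pi\<^sup>2 * G t + 4 * pi\<^sup>2 * (H t)\<^sup>2 - 8 * pi\<^sup>2 * (H t * dE u 0 t) - k * (deriv H t * dE u 0 t)"
      unfolding d2 nu1 G H w1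
      by (simp add: algebra_simps power2_eq_square[of "dE _ _ _"] power2_eq_square[of "2 * _"] kk)
  qed
qed

section \<open>Weight 0: rotation and quantization\<close>

lemma rotation_period:
  assumes w: "0 < w" and r: "continuous_on {0..1} r" and per: "one_periodic u" "one_periodic v"
    and u: "\<And>t. (u has_real_derivative r t * v t) (at t)"
    and v: "\<And>t. (v has_real_derivative - (w\<^sup>2 * r t * u t)) (at t)"
    and nontriv: "u s \<noteq> 0"
  shows "cos (w * integral {0..1} r) = 1"
proof -
  define R where "R t = integral {0..t} r" for t
  define y where "y t = v t / w" for t
  \<comment> \<open>\<open>p\<close> and \<open>q\<close> undo the rotation by the angle \<open>w * R t\<close>, so they are constant.\<close>
  define p where "p t = u t * cos (w * R t) - y t * sin (w * R t)" for t
  define q where "q t = u t * sin (w * R t) + y t * cos (w * R t)" for t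
  have y: "(y has_real_derivative - (w * r t * u t)) (at t)" for t
    using DERIV_cdivide[OF v[of t], of w] w by (simp add: y_def[abs_def] power2_eq_square mult.assoc)
  have vy: "v t = w * y t" for t using w by (simp add: y_def)
  \<comment> \<open>The conserved length carries nontriviality from the point \<open>s\<close> to
    the point 0, where the rotated vector is compared with itself.\<close>
  have "((\<lambda>t. (u t)\<^sup>2 + (y t)\<^sup>2) has_real_derivative 0) (at t)" for t
    by (auto intro!: derivative_eq_intros u y simp: vy)
  then obtain e where e: "(u t)\<^sup>2 + (y t)\<^sup>2 = e" for t
    using has_field_derivative_zero_constant[of UNIV "\<lambda>t. (u t)\<^sup>2 + (y t)\<^sup>2"] by auto
  have "e > 0"
    using e[of s] nontriv by (metis add_pos_nonneg zero_le_power2 zero_less_power2)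
  \<comment> \<open>\<open>R\<close> is an antiderivative of \<open>r\<close> within the unit
    interval only: for negative \<open>t\<close> its integral runs over the empty set.\<close>
  have deriv: "(R has_real_derivative r t) (at t within {0..1})"
    "(u has_real_derivative r t * v t) (at t within {0..1})"
    "(y has_real_derivative - (w * r t * u t)) (at t within {0..1})" if "t \<in> {0..1}" for t
    unfolding R_def[abs_def] using integral_has_real_derivative[OF r that] u y
    by (auto intro: has_field_derivative_at_within)
  have "(p has_real_derivative 0) (at t within {0..1})" if "t \<in> {0..1}" for t
    unfolding p_def
    by (auto intro!: derivative_eq_intros deriv that simp: vy algebra_simps)
  then have p: "p 1 = p 0"
    using has_field_derivative_zero_constant[OF convex_real_interval(5), of 0 1 p] by fastforce
  have "(q has_real_derivative 0) (at t within {0..1})" if "t \<in> {0..1}" for t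
    unfolding q_def
    by (auto intro!: derivative_eq_intros deriv that simp: vy algebra_simps)
  then have q: "q 1 = q 0"
    using has_field_derivative_zero_constant[OF convex_real_interval(5), of 0 1 q] by fastforce
  have per1: "u 1 = u 0" "y 1 = y 0"
    using per unfolding one_periodic_def y_def by (metis add_0)+
  define x where "x = w * R 1"
  have "u 0 * cos x - y 0 * sin x = u 0" "u 0 * sin x + y 0 * cos x = y 0"
    using p q by (simp_all add: p_def q_def per1 x_def R_def)
  \<comment> \<open>The rotation by \<open>x\<close> fixes the vector \<open>(u 0, y 0)\<close>.
    Pairing both sides with that vector leaves its squared length times
    \<open>cos x\<close>.\<close>
  then have "u 0 * (u 0 * cos x - y 0 * sin x) + y 0 * (u 0 * sin x + y 0 * cos x) = u 0 * u 0 + y 0 * y 0"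
    by simp
  then have "((u 0)\<^sup>2 + (y 0)\<^sup>2) * cos x = (u 0)\<^sup>2 + (y 0)\<^sup>2"
    by (simp add: algebra_simps power2_eq_square)
  then show ?thesis
    using \<open>e > 0\<close> e[of 0] by (simp add: x_def R_def)
qed

text \<open>Differentiating \<open>\<nu> * L^2 = 4 * pi^2\<close> twice requires no eigenfunctions.
  The mean value of \<open>H\<close> being zero gives L'(0) = 0, which removes the first derivative
  of \<nu> and all mixed terms, leaving \<nu>''(0) = - 8 pi^2 L''(0).\<close>

lemma quantized_second_variation:
  assumes I: "open I" "0 \<in> I" and r: "smooth_family I r" "\<And>t. r 0 t = 1"
    and \<nu>: "smooth_on I \<nu>" "\<nu> 0 = 4 * pi\<^sup>2"
    and H: "\<And>t. H t = 2 * dE r 0 t" and G: "\<And>t. G t = dE (dE r) 0 t + (dE r 0 t)\<^sup>2"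
    and H_int: "(H has_integral 0) {0..1}"
    and quantized: "\<And>E. E \<in> I \<Longrightarrow> 0 < \<nu> E \<Longrightarrow> cos (sqrt (\<nu> E) * integral {0..1} (r E)) = 1"
  shows "deriv (deriv \<nu>) 0 =
    - 8 * pi\<^sup>2 * integral {0..1} G + 2 * pi\<^sup>2 * integral {0..1} (\<lambda>t. (H t)\<^sup>2)"
proof -
  define L where "L E = integral {0..1} (r E)" for E
  define L1 where "L1 E = integral {0..1} (dE r E)" for E
  define L2 where "L2 = integral {0..1} (dE (dE r) 0)"
  have L: "(L has_real_derivative L1 E) (at E)" if "E \<in> I" for E
    using has_derivative_integral_parameter[OF I(1) r(1) that] unfolding L_def L1_def .
  have L1: "(L1 has_real_derivative L2) (at 0)"
    using has_derivative_integral_parameter[OF I(1) smooth_family_dE[OF r(1)] I(2)]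
    unfolding L2_def L1_def .
  note dnu = smooth_on_real_derivatives[OF I(1) \<nu>(1)]
  have "r 0 = (\<lambda>t. 1)" using r(2) by auto
  then have L_0: "L 0 = 1" by (simp add: L_def)
  have "dE r 0 = (\<lambda>t. 1 / 2 * H t)" using H by auto
  then have L1_0: "L1 0 = 0"
    using has_integral_mult_right[OF H_int, of "1 / 2"] by (auto simp: L1_def has_integral_iff)
  have nu_cont: "(\<nu> \<longlongrightarrow> 4 * pi\<^sup>2) (nhds 0)"
    using dnu(1)[OF I(2)] \<nu>(2) by (metis DERIV_isCont continuous_at tendsto_at_iff_tendsto_nhds)
  have L_cont: "(L \<longlongrightarrow> 1) (nhds 0)"
    using L[OF I(2)] L_0 by (metis DERIV_isCont continuous_at tendsto_at_iff_tendsto_nhds)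
  have "((\<lambda>E. sqrt (\<nu> E) * L E) \<longlongrightarrow> sqrt (4 * pi\<^sup>2) * 1) (nhds 0)"
    by (intro tendsto_intros nu_cont L_cont)
  then have lim: "((\<lambda>E. sqrt (\<nu> E) * L E) \<longlongrightarrow> 2 * pi) (nhds 0)"
    by (simp add: real_sqrt_mult)
  \<comment> \<open>The angle equals 2 pi at E = 0. The open window from 0 to 4 pi contains no other
    positive multiple of 2 pi, so continuity singles out the integer 1.\<close>
  have "\<forall>\<^sub>F E in nhds 0. E \<in> I \<and> 0 < \<nu> E \<and> 0 < sqrt (\<nu> E) * L E \<and> sqrt (\<nu> E) * L E < 4 * pi"
    using order_tendstoD(1)[OF nu_cont, of 0] order_tendstoD(1)[OF lim, of 0]
      order_tendstoD(2)[OF lim, of "4 * pi"] eventually_nhds_in_open[OF I]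
    by (intro eventually_conj) auto
  then obtain U where U: "open U" "0 \<in> U"
    and near: "\<And>E. E \<in> U \<Longrightarrow> E \<in> I" "\<And>E. E \<in> U \<Longrightarrow> 0 < \<nu> E"
      "\<And>E. E \<in> U \<Longrightarrow> 0 < sqrt (\<nu> E) * L E" "\<And>E. E \<in> U \<Longrightarrow> sqrt (\<nu> E) * L E < 4 * pi"
    unfolding eventually_nhds by blast
  have prod: "\<nu> E * (L E)\<^sup>2 = 4 * pi\<^sup>2" if "E \<in> U" for E
  proof -
    have "cos (sqrt (\<nu> E) * L E) = 1"
      using quantized near(1,2)[OF that] unfolding L_def by blast
    then obtain n :: int where n: "sqrt (\<nu> E) * L E = of_int n * 2 * pi"
      unfolding cos_one_2pi_int by auto
    have "0 < of_int n * 2 * pi" "of_int n * 2 * pi < 4 * pi"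
      using near(3,4)[OF that] unfolding n by auto
    then have "n = 1"
      by (auto simp: zero_less_mult_iff)
    then have "(sqrt (\<nu> E) * L E)\<^sup>2 = (2 * pi)\<^sup>2" using n by simp
    then show ?thesis using near(2)[OF that] by (simp add: power_mult_distrib)
  qed
  have d1: "deriv \<nu> E * (L E)\<^sup>2 + \<nu> E * (2 * L E * L1 E) = 0" if "E \<in> U" for E
  proof -
    have "((\<lambda>E. \<nu> E * (L E)\<^sup>2) has_real_derivative
        deriv \<nu> E * (L E)\<^sup>2 + \<nu> E * (2 * L E * L1 E)) (at E)"
      by (auto intro!: derivative_eq_intros dnu L near that)
    moreover have "((\<lambda>E. \<nu> E * (L E)\<^sup>2) has_real_derivative 0) (at E)"
      by (rule has_field_derivative_transform_within_open[OF DERIV_const U(1) that])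
        (simp add: prod)
    ultimately show ?thesis using DERIV_unique by blast
  qed
  have nu1: "deriv \<nu> 0 = 0" using d1[OF U(2)] by (simp add: L_0 L1_0)
  have "((\<lambda>E. deriv \<nu> E * (L E)\<^sup>2 + \<nu> E * (2 * L E * L1 E)) has_real_derivative
      deriv (deriv \<nu>) 0 + 8 * pi\<^sup>2 * L2) (at 0)"
    by (auto intro!: derivative_eq_intros dnu L L1 I simp: L_0 L1_0 nu1 \<nu>(2))
  moreover have "((\<lambda>E. deriv \<nu> E * (L E)\<^sup>2 + \<nu> E * (2 * L E * L1 E)) has_real_derivative 0) (at 0)"
    by (rule has_field_derivative_transform_within_open[OF DERIV_const U]) (simp add: d1)
  ultimately have nu2: "deriv (deriv \<nu>) 0 + 8 * pi\<^sup>2 * L2 = 0" using DERIV_unique by blast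
  have cont: "continuous_on {0..1} (dE r 0)" "continuous_on {0..1} (dE (dE r) 0)"
    by (intro smooth_family_continuous_t[OF _ I(2)] smooth_family_dE r)+
  \<comment> \<open>The coefficient \<open>1 / 4\<close> arises because \<open>dE r\<close> is half
    of \<open>H\<close>; multiplied by \<open>8 * pi^2\<close> it becomes the
    \<open>2 * pi^2\<close> of (d).\<close>
  have "L2 = integral {0..1} (\<lambda>t. G t - 1 / 4 * (H t)\<^sup>2)"
    unfolding L2_def by (intro integral_cong) (simp add: G H power2_eq_square)
  also have "\<dots> = integral {0..1} G - 1 / 4 * integral {0..1} (\<lambda>t. (H t)\<^sup>2)"
    unfolding G[abs_def] H[abs_def] using cont
    by (subst integral_diff) (auto intro!: integrable_continuous_real continuous_intros)
  finally have L2: "L2 = integral {0..1} G - 1 / 4 * integral {0..1} (\<lambda>t. (H t)\<^sup>2)" .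
  show ?thesis using nu2 unfolding L2 by (simp add: algebra_simps)
qed

section \<open>Integrals over a period and the individual Dirac weights\<close>

lemma has_integral_reflect_unit:
  assumes "(f has_integral i) {0..1::real}"
  shows "((\<lambda>t. f (1 - t)) has_integral i) {0..1}"
proof -
  have "(\<lambda>x. 1 - x) ` {0..1::real} = {0..1}"
    by (auto intro!: image_eqI[of _ _ "1 - _"])
  then show ?thesis
    using has_integral_affinity[of f i 0 1 "- 1" 1] assms by simp
qed

lemma integral_odd_unit:
  assumes "f integrable_on {0..1}" "\<And>t. f (1 - t) = - f t"
  shows "integral {0..1::real} f = (0::real)"
proof -
  have "((\<lambda>t. - f t) has_integral integral {0..1} f) {0..1}"
    using has_integral_reflect_unit[OF integrable_integral[OF assms(1)]] by (simp add: assms(2))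
  then have "(f has_integral - integral {0..1} f) {0..1}"
    by (simp add: has_integral_neg_iff)
  then show ?thesis
    by (simp add: has_integral_iff)
qed

lemma has_integral_trig_squared:
  "((\<lambda>t. (sin (2 * pi * t))\<^sup>2) has_integral 1 / 2) {0..1}"
  "((\<lambda>t. (cos (2 * pi * t))\<^sup>2) has_integral 1 / 2) {0..1}"
proof -
  have c: "(cos x)\<^sup>2 = 1 - (sin x)\<^sup>2" for x :: real by (simp add: cos_squared_eq)
  \<comment> \<open>One antiderivative for both integrals: by the double-angle formula, s = 1
    belongs to the squared sine and s = -1 to the squared cosine.\<close>
  define F where "F s t = t / 2 - s * (sin (2 * pi * t) * cos (2 * pi * t) / (4 * pi))" for s t
  have F: "(F s has_real_derivative 1 / 2 - s * ((cos (2 * pi * t))\<^sup>2 - (sin (2 * pi * t))\<^sup>2) / 2)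
      (at t within {0..1})" for s t
    unfolding F_def
    by (auto intro!: derivative_eq_intros simp: field_simps power2_eq_square)
  have "((\<lambda>t. 1 / 2 - s * ((cos (2 * pi * t))\<^sup>2 - (sin (2 * pi * t))\<^sup>2) / 2)
      has_integral F s 1 - F s 0) {0..1}" for s
    using F by (intro fundamental_theorem_of_calculus)
      (auto simp flip: has_real_derivative_iff_has_vector_derivative)
  from this[of 1] this[of "- 1"] show "((\<lambda>t. (sin (2 * pi * t))\<^sup>2) has_integral 1 / 2) {0..1}"
    "((\<lambda>t. (cos (2 * pi * t))\<^sup>2) has_integral 1 / 2) {0..1}"
    by (simp_all add: F_def c diff_divide_distrib)
qed

text \<open>Equates the formulas for the weights \<open>1\<close> and \<open>-1\<close>; the integrand is half their difference.\<close>

lemma opposite_weight_integral: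
  assumes H: "\<And>t. (H has_real_derivative H' t) (at t)" "one_periodic H"
    and C: "periodic_solution (\<lambda>t x. - 4 * pi\<^sup>2 * H t - pi * H' t) C"
    and X: "periodic_solution (\<lambda>t x. - 4 * pi\<^sup>2 * H t + pi * H' t) X"
  shows "((\<lambda>t. (- 4 * pi\<^sup>2 * H t - pi * H' t) * C t - (- 4 * pi\<^sup>2 * H t + pi * H' t) * X t)
    has_integral 0) {0..1}"
proof -
  obtain C' where C': "\<And>t. (C has_real_derivative C' t) (at t)"
    "\<And>t. (C' has_real_derivative - 4 * pi\<^sup>2 * H t - pi * H' t) (at t)" "one_periodic C" "one_periodic C'"
    using periodic_solution_has_derivatives[OF C] by blast
  obtain X' where X': "\<And>t. (X has_real_derivative X' t) (at t)"
    "\<And>t. (X' has_real_derivative - 4 * pi\<^sup>2 * H t + pi * H' t) (at t)" "one_periodic X" "one_periodic X'"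
    using periodic_solution_has_derivatives[OF X] by blast
  have "((\<lambda>t. C' t - X' t + 2 * pi * H t) has_real_derivative 0) (at t)" for t
    by (auto intro!: derivative_eq_intros C' X' H)
  then obtain k where k: "C' t - X' t + 2 * pi * H t = k" for t
    using has_field_derivative_zero_constant[of UNIV "\<lambda>t. C' t - X' t + 2 * pi * H t"] by auto
  \<comment> \<open>The integrand is \<open>C'' * C - X'' * X\<close>, that is, the derivative of
    \<open>C * C' - X * X'\<close> minus \<open>(C' - X') * (C' + X')\<close>. Here
    \<open>C' - X' = k - 2 * pi * H\<close>, and adding the two equations gives
    \<open>H = - (C'' + X'') / (8 * pi^2)\<close>; so the product is the derivative of the last two
    terms of \<open>\<Phi>\<close>.\<close>
  define \<Phi> where "\<Phi> t = C t * C' t - X t * X' t - (C' t + X' t)\<^sup>2 / (8 * pi) - k * (C t + X t)" for t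
  show ?thesis
  proof (rule periodic_derivative_has_integral)
    show "one_periodic \<Phi>"
      using C'(3,4) X'(3,4) by (simp add: one_periodic_def \<Phi>_def)
    show "(\<Phi> has_real_derivative (- 4 * pi\<^sup>2 * H t - pi * H' t) * C t
        - (- 4 * pi\<^sup>2 * H t + pi * H' t) * X t) (at t)" for t
      unfolding \<Phi>_def k[of t, symmetric]
      by (auto intro!: derivative_eq_intros C' X' simp: k[of t, symmetric] field_simps power2_eq_square)
  qed
qed

lemma dirac_unit_weight_variation:
  assumes I: "open I" "0 \<in> I" and h: "smooth_family I h" "\<And>E. E \<in> I \<Longrightarrow> one_periodic (h E)"
      "\<And>E t. E \<in> I \<Longrightarrow> 0 < h E t" "\<And>t. h 0 t = 1"
    and spec: "dirac_spectral_function I h l \<nu> (\<lambda>t. 1)" and l: "l\<^sup>2 = 1"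
  defines "r \<equiv> \<lambda>E t. (h E t)\<^sup>2"
  assumes H: "\<And>t. H t = 2 * dE r 0 t" and G: "\<And>t. G t = dE (dE r) 0 t + (dE r 0 t)\<^sup>2"
    and H_int: "(H has_integral 0) {0..1}"
  shows "\<exists>C. periodic_solution (\<lambda>t x. - 4 * pi\<^sup>2 * H t - pi * of_int l * deriv H t) C \<and>
    ((\<lambda>t. - 8 * pi\<^sup>2 * G t + 4 * pi\<^sup>2 * (H t)\<^sup>2 - 8 * pi\<^sup>2 * (H t * C t)
      - 2 * pi * of_int l * (deriv H t * C t)) has_integral deriv (deriv \<nu>) 0) {0..1}"
proof -
  obtain A where nu: "smooth_on I \<nu>" "\<nu> 0 = 4 * pi\<^sup>2" and A: "smooth_family I A" "A 0 = (\<lambda>t. 1)"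
    and eig: "\<And>E. E \<in> I \<Longrightarrow> A E \<in> eigenspace (dirac_coeff l (h E) (\<nu> E))"
    using spec unfolding spectral_function_def smooth_family_def by auto
  have "\<exists>w. first_order_system I (2 * pi * of_int l) r \<nu> (\<lambda>E t. h E t * A E t) w"
    unfolding r_def by (rule dirac_family_system[OF I(1) h(1-3) A(1) eig])
  then obtain w where sys: "first_order_system I (2 * pi * of_int l) r \<nu> (\<lambda>E t. h E t * A E t) w"
    by (rule exE)
  have r: "smooth_family I r" "\<And>t. r 0 t = 1" "\<And>E. E \<in> I \<Longrightarrow> one_periodic (r E)"
    unfolding r_def using h I by (auto intro!: smooth_family_intros simp: one_periodic_def)
  \<comment> \<open>Only the square of the weight matters here; its sign survives solely in the
    terms with \<open>deriv H\<close>.\<close>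
  have "(2 * pi * of_int l)\<^sup>2 = 4 * pi\<^sup>2"
    using l by (simp add: power_mult_distrib flip: of_int_power)
  note k = this
  have u0: "h 0 t * A 0 t = 1" for t by (simp add: h(4) A(2))
  have k2: "2 * pi * real_of_int l / 2 = pi * of_int l" by simp
  note var = first_order_second_variation[OF I r nu sys k u0 H G H_int]
  show ?thesis
    by (rule exI[of _ "dE (\<lambda>E t. h E t * A E t) 0"], rule conjI)
      (use var[unfolded k2] in auto)
qed

lemma dirac_zero_weight_variation:
  assumes I: "open I" "0 \<in> I" and h: "smooth_family I h" "\<And>E. E \<in> I \<Longrightarrow> one_periodic (h E)"
      "\<And>E t. E \<in> I \<Longrightarrow> 0 < h E t" "\<And>t. h 0 t = 1"
    and spec: "dirac_spectral_function I h 0 \<nu> a"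
  defines "r \<equiv> \<lambda>E t. (h E t)\<^sup>2"
  assumes H: "\<And>t. H t = 2 * dE r 0 t" and G: "\<And>t. G t = dE (dE r) 0 t + (dE r 0 t)\<^sup>2"
    and H_int: "(H has_integral 0) {0..1}"
  shows "deriv (deriv \<nu>) 0 =
    - 8 * pi\<^sup>2 * integral {0..1} G + 2 * pi\<^sup>2 * integral {0..1} (\<lambda>t. (H t)\<^sup>2)"
proof -
  obtain A where nu: "smooth_on I \<nu>" "\<nu> 0 = 4 * pi\<^sup>2" and A: "smooth_family I A"
    and eig: "\<And>E. E \<in> I \<Longrightarrow> A E \<in> eigenspace (dirac_coeff 0 (h E) (\<nu> E))"
    and nontriv: "\<And>E. E \<in> I \<Longrightarrow> \<exists>t. A E t \<noteq> 0"
    using spec unfolding spectral_function_def smooth_family_def by auto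
  have "\<exists>w. first_order_system I (2 * pi * of_int 0) r \<nu> (\<lambda>E t. h E t * A E t) w"
    unfolding r_def by (rule dirac_family_system[OF I(1) h(1-3) A eig])
  then obtain w where sys: "first_order_system I (2 * pi * of_int 0) r \<nu> (\<lambda>E t. h E t * A E t) w"
    by (rule exE)
  have r: "smooth_family I r" "\<And>t. r 0 t = 1"
    unfolding r_def using h I by (auto intro!: smooth_family_intros)
  show ?thesis
  proof (rule quantized_second_variation[OF I r nu H G H_int])
    fix E assume E: "E \<in> I" "0 < \<nu> E"
    obtain s where "A E s \<noteq> 0" using nontriv[OF E(1)] by blast
    \<comment> \<open>Positivity of the conformal factor transfers nontriviality from the
      eigenfunction to u, and excludes the rest solution of the rotating system.\<close>
    then have s: "h E s * A E s \<noteq> 0"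
      using h(3)[OF E(1), of s] by simp
    show "cos (sqrt (\<nu> E) * integral {0..1} (r E)) = 1"
      by (rule rotation_period[where u="\<lambda>t. h E t * A E t" and v="w E" and s=s])
        (use E sys s smooth_family_continuous_t[OF r(1) E(1)] in \<open>simp_all add: first_order_system_def\<close>)
  qed
qed

section \<open>Taylor coefficients of the metric and assembly of the five formulas\<close>

theorem theorem2:
  fixes I :: "real set" and h :: "real \<Rightarrow> real \<Rightarrow> real" and H G :: "real \<Rightarrow> real"
    and \<mu>1 \<mu>2 \<mu>3 :: "real \<Rightarrow> real"
    and \<Lambda>1 \<Lambda>2 \<Lambda>3 :: "real \<Rightarrow> real"
  assumes deformation: "metric_deformation I h"
    and expansion: "\<And>t. (\<lambda>E. h E t ^ 4 - (1 + E * H t + E\<^sup>2 * G t)) \<in> O[at 0](\<lambda>E. E ^ 3)"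
    and symmetry: "\<And>E t. E \<in> I \<Longrightarrow> h E t ^ 4 = h E (1 - t) ^ 4"
    and H_sin: "integral {0..1} (\<lambda>t. H t * (sin (2 * pi * t))\<^sup>2) = 0"
    and H_cos: "integral {0..1} (\<lambda>t. H t * (cos (2 * pi * t))\<^sup>2) = 0"
    and mu1: "laplace_spectral_function I h 0 \<mu>1 (\<lambda>t. sin (2 * pi * t))"
    and mu2: "laplace_spectral_function I h 0 \<mu>2 (\<lambda>t. cos (2 * pi * t))"
    and mu3: "\<And>k. k \<in> {1, -1} \<Longrightarrow> laplace_spectral_function I h k \<mu>3 (\<lambda>t. 1)"
    and lambda1: "\<exists>A0. dirac_spectral_function I h 0 \<Lambda>1 A0"
    and lambda1_mult: "\<And>E. E \<in> I \<Longrightarrow> multiplicity_of (dirac_coeff 0 (h E) (\<Lambda>1 E)) = 2"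
    and lambda2: "dirac_spectral_function I h (-1) \<Lambda>2 (\<lambda>t. 1)"
    and lambda3: "dirac_spectral_function I h 1 \<Lambda>3 (\<lambda>t. 1)"
    and simple: "\<And>E. E \<in> I \<Longrightarrow> E \<noteq> 0 \<Longrightarrow> \<mu>1 E \<noteq> \<mu>2 E \<and>
        multiplicity_of (laplace_coeff 0 (h E) (\<mu>1 E)) = 1 \<and>
        multiplicity_of (laplace_coeff 0 (h E) (\<mu>2 E)) = 1"
  shows
    "(let S = periodic_solution
            (\<lambda>t x. - 4 * pi\<^sup>2 * H t * sin (2 * pi * t) - 4 * pi\<^sup>2 * x)
      in (\<exists>C. S C) \<and>
         (\<forall>C. S C \<longrightarrow> deriv (deriv \<mu>1) 0 =
            - 16 * pi\<^sup>2 * integral {0..1} (\<lambda>t. G t * (sin (2 * pi * t))\<^sup>2)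
            - 16 * pi\<^sup>2 * integral {0..1} (\<lambda>t. H t * C t * sin (2 * pi * t)))) \<and>
     (let S = periodic_solution
            (\<lambda>t x. - 4 * pi\<^sup>2 * H t * cos (2 * pi * t) - 4 * pi\<^sup>2 * x)
      in (\<exists>C. S C) \<and>
         (\<forall>C. S C \<longrightarrow> deriv (deriv \<mu>2) 0 =
            - 16 * pi\<^sup>2 * integral {0..1} (\<lambda>t. G t * (cos (2 * pi * t))\<^sup>2)
            - 16 * pi\<^sup>2 * integral {0..1} (\<lambda>t. H t * C t * cos (2 * pi * t)))) \<and>
     (let S = periodic_solution (\<lambda>t x. - 4 * pi\<^sup>2 * H t)
      in (\<exists>C. S C) \<and>
         (\<forall>C. S C \<longrightarrow> deriv (deriv \<mu>3) 0 =
            - 8 * pi\<^sup>2 * integral {0..1} G - 8 * pi\<^sup>2 * integral {0..1} (\<lambda>t. H t * C t))) \<and>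
     deriv (deriv \<Lambda>1) 0 =
       - 8 * pi\<^sup>2 * integral {0..1} G + 2 * pi\<^sup>2 * integral {0..1} (\<lambda>t. (H t)\<^sup>2) \<and>
     (let S = periodic_solution (\<lambda>t x. - 4 * pi\<^sup>2 * H t - pi * deriv H t)
      in (\<exists>C. S C) \<and>
         (\<forall>C. S C \<longrightarrow>
            deriv (deriv \<Lambda>2) 0 = deriv (deriv \<Lambda>3) 0 \<and>
            deriv (deriv \<Lambda>3) 0 =
              - 8 * pi\<^sup>2 * integral {0..1} G + 4 * pi\<^sup>2 * integral {0..1} (\<lambda>t. (H t)\<^sup>2)
              - 8 * pi\<^sup>2 * integral {0..1} (\<lambda>t. H t * C t)
              - 2 * pi * integral {0..1} (\<lambda>t. deriv H t * C t)))"
proof -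
  have I: "open I" "0 \<in> I" and h: "smooth_family I h" "\<And>E. E \<in> I \<Longrightarrow> one_periodic (h E)"
      "\<And>E t. E \<in> I \<Longrightarrow> 0 < h E t" "\<And>t. h 0 t = 1"
    using deformation unfolding metric_deformation_def smooth_family_def by auto
  define r where "r E t = (h E t)\<^sup>2" for E t
  have r: "smooth_family I r" "\<And>t. r 0 t = 1" "\<And>E. E \<in> I \<Longrightarrow> one_periodic (r E)"
    unfolding r_def[abs_def] using h I by (auto intro!: smooth_family_intros simp: one_periodic_def)
  have h4: "h E t ^ 4 = (r E t)\<^sup>2" for E t by (simp add: r_def)
  have H: "H t = 2 * dE r 0 t" and G: "G t = dE (dE r) 0 t + (dE r 0 t)\<^sup>2" for t
  proof -
    have d1: "((\<lambda>E. (r E t)\<^sup>2) has_real_derivative 2 * r E t * dE r E t) (at E)" if "E \<in> I" for E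
      using that by (auto intro!: derivative_eq_intros dE_has_derivative[OF r(1)])
    have d2: "((\<lambda>E. 2 * r E t * dE r E t) has_real_derivative
        2 * (dE r E t)\<^sup>2 + 2 * r E t * dE (dE r) E t) (at E)" if "E \<in> I" for E
      using that by (auto intro!: derivative_eq_intros dE_has_derivative[OF r(1)]
          dE_has_derivative[OF smooth_family_dE[OF r(1)]] simp: power2_eq_square)
    have "(\<lambda>E. (r E t)\<^sup>2 - ((r 0 t)\<^sup>2 + E * H t + E\<^sup>2 * G t)) \<in> O[at 0](\<lambda>E. E ^ 3)"
      using expansion[of t] by (simp add: h4 r(2))
    note taylor_coefficients_unique[OF I d1 d2 this]
    then show "H t = 2 * dE r 0 t" "G t = dE (dE r) 0 t + (dE r 0 t)\<^sup>2"
      by (auto simp: r(2))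
  qed
  have H_smooth: "(H has_real_derivative deriv H t) (at t)" for t
  proof -
    have "(H has_real_derivative 2 * dT (dE r) 0 t) (at t)"
      unfolding H[abs_def] by (intro DERIV_cmult dT_has_derivative[OF smooth_family_dE[OF r(1)] I(2)])
    from this DERIV_imp_deriv[OF this] show ?thesis by simp
  qed
  have H'_cont: "continuous_on {0..1} (deriv H)"
  proof -
    have "deriv H = (\<lambda>t. 2 * dT (dE r) 0 t)"
      unfolding H[abs_def] by (intro ext DERIV_imp_deriv DERIV_cmult
          dT_has_derivative[OF smooth_family_dE[OF r(1)] I(2)])
    then show ?thesis
      using smooth_family_continuous_t[OF smooth_family_dT[OF smooth_family_dE[OF r(1)]] I(2)]
      by (auto intro!: continuous_intros)
  qed
  have H_per: "one_periodic H"
    using one_periodic_dE[OF I(1) r(1) I(2) r(3)] by (simp add: one_periodic_def H)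
  have H_cont: "continuous_on {0..1} H" and G_cont: "continuous_on {0..1} G"
    unfolding H[abs_def] G[abs_def]
    by (intro continuous_intros smooth_family_continuous_t[OF _ I(2)] smooth_family_dE r)+
  have H_int: "(H has_integral 0) {0..1}"
  proof -
    have "((\<lambda>t. H t * (sin (2 * pi * t))\<^sup>2 + H t * (cos (2 * pi * t))\<^sup>2) has_integral 0 + 0) {0..1}"
      using H_sin H_cos H_cont
      by (intro has_integral_add) (auto simp: has_integral_iff intro!: integrable_continuous_real continuous_intros)
    then show ?thesis by (simp flip: distrib_left)
  qed
  \<comment> \<open>The symmetry is given for \<open>h^4 = r^2\<close>; as \<open>r\<close> is
    nonnegative it passes to \<open>r\<close>, and then to the E-derivative at 0.\<close>
  have H_sym: "H (1 - t) = H t" for t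
  proof -
    have "r E t = r E (1 - t)" if "E \<in> I" for E
    proof (rule power2_eq_imp_eq)
      show "(r E t)\<^sup>2 = (r E (1 - t))\<^sup>2" using symmetry[OF that, of t] by (simp only: h4)
    qed (simp_all add: r_def)
    then have "dE r 0 t = dE r 0 (1 - t)"
      by (rule dE_eqI[OF I(1) r(1) I(2) _ dE_has_derivative[OF r(1) I(2)]])
    then show ?thesis by (simp add: H)
  qed
  have int: "f integrable_on {0..1}" if "continuous_on {0..1} f" for f :: "real \<Rightarrow> real"
    using that by (rule integrable_continuous_real)
  \<comment> \<open>\<open>H\<close> is even and the product of sine and cosine is odd under t -> 1
    - t. With the two integral hypotheses, every matrix element of \<open>H\<close> on the span of
    sin and cos is now zero.\<close>
  have H_sincos: "integral {0..1} (\<lambda>t. H t * (sin (2 * pi * t) * cos (2 * pi * t))) = 0"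
  proof (rule integral_odd_unit)
    show "(\<lambda>t. H t * (sin (2 * pi * t) * cos (2 * pi * t))) integrable_on {0..1}"
      by (intro int continuous_intros H_cont)
    have "sin (2 * pi * (1 - t)) = - sin (2 * pi * t)" "cos (2 * pi * (1 - t)) = cos (2 * pi * t)" for t
      by (simp_all add: right_diff_distrib sin_diff cos_diff)
    then show "H (1 - t) * (sin (2 * pi * (1 - t)) * cos (2 * pi * (1 - t)))
        = - (H t * (sin (2 * pi * t) * cos (2 * pi * t)))" for t
      by (simp add: H_sym)
  qed
  have H_osc: "integral {0..1} (\<lambda>t. H t * D t * sin (2 * pi * t)) = 0"
    "integral {0..1} (\<lambda>t. H t * D t * cos (2 * pi * t)) = 0"
    if osc: "periodic_solution (\<lambda>t x. - ((4 * pi\<^sup>2 - 0) * x)) D" for D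
  proof -
    obtain D' where D': "\<And>t. (D has_real_derivative D' t) (at t)"
      "\<And>t. (D' has_real_derivative - ((4 * pi\<^sup>2 - 0) * D t)) (at t)" "one_periodic D" "one_periodic D'"
      using periodic_solution_has_derivatives[OF osc] by blast
    have D'': "(D' has_real_derivative - ((2 * pi)\<^sup>2 * D t)) (at t)" for t
      using D'(2)[of t] by (simp add: power_mult_distrib)
    from harmonic_oscillator_solution[OF _ D'(1) D'']
    obtain a b where D: "D t = a * cos (2 * pi * t) + b * sin (2 * pi * t)" for t
      by auto
    have i: "((\<lambda>t. H t * (sin (2 * pi * t))\<^sup>2) has_integral 0) {0..1}"
      "((\<lambda>t. H t * (cos (2 * pi * t))\<^sup>2) has_integral 0) {0..1}"
      "((\<lambda>t. H t * (sin (2 * pi * t) * cos (2 * pi * t))) has_integral 0) {0..1}"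
      using H_sin H_cos H_sincos
      by (auto simp: has_integral_iff intro!: int continuous_intros H_cont)
    have "((\<lambda>t. a * (H t * (sin (2 * pi * t) * cos (2 * pi * t))) + b * (H t * (sin (2 * pi * t))\<^sup>2))
        has_integral a * 0 + b * 0) {0..1}"
      by (intro has_integral_add has_integral_mult_right i)
    then show "integral {0..1} (\<lambda>t. H t * D t * sin (2 * pi * t)) = 0"
      by (intro integral_unique) (simp add: D power2_eq_square algebra_simps)
    have "((\<lambda>t. a * (H t * (cos (2 * pi * t))\<^sup>2) + b * (H t * (sin (2 * pi * t) * cos (2 * pi * t))))
        has_integral a * 0 + b * 0) {0..1}"
      by (intro has_integral_add has_integral_mult_right i)
    then show "integral {0..1} (\<lambda>t. H t * D t * cos (2 * pi * t)) = 0"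
      by (intro integral_unique) (simp add: D power2_eq_square algebra_simps)
  qed
  have laplace: "(\<lambda>E. laplace_coeff k (h E)) = (\<lambda>E m t. m * (r E t)\<^sup>2 - 4 * pi\<^sup>2 * (of_int k)\<^sup>2)" for k
    by (simp add: fun_eq_iff laplace_coeff_def h4)
  have spec1: "spectral_function I (\<lambda>E m t. m * (r E t)\<^sup>2 - 0) \<mu>1 (\<lambda>t. sin (2 * pi * t))"
    and spec2: "spectral_function I (\<lambda>E m t. m * (r E t)\<^sup>2 - 0) \<mu>2 (\<lambda>t. cos (2 * pi * t))"
    and spec3: "spectral_function I (\<lambda>E m t. m * (r E t)\<^sup>2 - 4 * pi\<^sup>2) \<mu>3 (\<lambda>t. 1)"
    using mu1 mu2 mu3[of 1] by (simp_all add: laplace)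
  note a = laplace_second_variation[OF I r(1,2) H G spec1 has_integral_trig_squared(1) _ H_sin H_osc(1)]
  note b = laplace_second_variation[OF I r(1,2) H G spec2 has_integral_trig_squared(2) _ H_cos H_osc(2)]
  have H_const: "integral {0..1} (\<lambda>t. H t * D t * 1) = 0"
    if "periodic_solution (\<lambda>t x. - ((4 * pi\<^sup>2 - 4 * pi\<^sup>2) * x)) D" for D
  proof -
    have "periodic_solution (\<lambda>t x. 0) D" using that by simp
    from periodic_affine_constant[OF this] obtain c where "\<And>t. D t = c" by auto
    then show ?thesis using has_integral_mult_left[OF H_int, of c] by (simp add: has_integral_iff)
  qed
  have one: "((\<lambda>t. (1::real)\<^sup>2) has_integral 1) {0..1::real}"
    using has_integral_const_real[of "1::real" 0 1] by simp
  have H_one: "integral {0..1} (\<lambda>t. H t * 1\<^sup>2) = 0" using H_int by (simp add: has_integral_iff)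
  note c = laplace_second_variation[OF I r(1,2) H G spec3 one _ H_one H_const]
  have rr: "r = (\<lambda>E t. (h E t)\<^sup>2)" by (simp add: fun_eq_iff r_def)
  obtain a0 where l1: "dirac_spectral_function I h 0 \<Lambda>1 a0" using lambda1 by blast
  have d: "deriv (deriv \<Lambda>1) 0 =
      - 8 * pi\<^sup>2 * integral {0..1} G + 2 * pi\<^sup>2 * integral {0..1} (\<lambda>t. (H t)\<^sup>2)"
    by (rule dirac_zero_weight_variation[OF I h l1 H[unfolded rr] G[unfolded rr] H_int])
  have "\<exists>C. periodic_solution (\<lambda>t x. - 4 * pi\<^sup>2 * H t - pi * of_int (- 1) * deriv H t) C \<and>
    ((\<lambda>t. - 8 * pi\<^sup>2 * G t + 4 * pi\<^sup>2 * (H t)\<^sup>2 - 8 * pi\<^sup>2 * (H t * C t)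
      - 2 * pi * of_int (- 1) * (deriv H t * C t)) has_integral deriv (deriv \<Lambda>2) 0) {0..1}"
    by (rule dirac_unit_weight_variation[OF I h lambda2 _ H[unfolded rr] G[unfolded rr] H_int]) simp_all
  then obtain X where X: "periodic_solution (\<lambda>t x. - 4 * pi\<^sup>2 * H t + pi * deriv H t) X"
    "((\<lambda>t. - 8 * pi\<^sup>2 * G t + 4 * pi\<^sup>2 * (H t)\<^sup>2 - 8 * pi\<^sup>2 * (H t * X t)
      + 2 * pi * (deriv H t * X t)) has_integral deriv (deriv \<Lambda>2) 0) {0..1}"
    by auto
  have "\<exists>C. periodic_solution (\<lambda>t x. - 4 * pi\<^sup>2 * H t - pi * of_int 1 * deriv H t) C \<and>
    ((\<lambda>t. - 8 * pi\<^sup>2 * G t + 4 * pi\<^sup>2 * (H t)\<^sup>2 - 8 * pi\<^sup>2 * (H t * C t)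
      - 2 * pi * of_int 1 * (deriv H t * C t)) has_integral deriv (deriv \<Lambda>3) 0) {0..1}"
    by (rule dirac_unit_weight_variation[OF I h lambda3 _ H[unfolded rr] G[unfolded rr] H_int]) simp_all
  then obtain Y where Y: "periodic_solution (\<lambda>t x. - 4 * pi\<^sup>2 * H t - pi * deriv H t) Y"
    "((\<lambda>t. - 8 * pi\<^sup>2 * G t + 4 * pi\<^sup>2 * (H t)\<^sup>2 - 8 * pi\<^sup>2 * (H t * Y t)
      - 2 * pi * (deriv H t * Y t)) has_integral deriv (deriv \<Lambda>3) 0) {0..1}"
    by auto
  \<comment> \<open>The formulas for the weights 1 and -1 involve solutions \<open>Y\<close> and
    \<open>X\<close> of different equations. Subtracting twice the null integrand of
    \<open>opposite_weight_integral\<close> turns the integrand for \<open>Y\<close> into that for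
    \<open>X\<close>.\<close>
  have e23: "deriv (deriv \<Lambda>2) 0 = deriv (deriv \<Lambda>3) 0"
  proof -
    have "((\<lambda>t. (- 8 * pi\<^sup>2 * G t + 4 * pi\<^sup>2 * (H t)\<^sup>2 - 8 * pi\<^sup>2 * (H t * Y t)
        - 2 * pi * (deriv H t * Y t)) - 2 * ((- 4 * pi\<^sup>2 * H t - pi * deriv H t) * Y t
        - (- 4 * pi\<^sup>2 * H t + pi * deriv H t) * X t)) has_integral deriv (deriv \<Lambda>3) 0 - 2 * 0) {0..1}"
      by (intro has_integral_diff[OF Y(2) has_integral_mult_right]
          opposite_weight_integral H_smooth H_per Y(1) X(1))
    then have "((\<lambda>t. - 8 * pi\<^sup>2 * G t + 4 * pi\<^sup>2 * (H t)\<^sup>2 - 8 * pi\<^sup>2 * (H t * X t)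
        + 2 * pi * (deriv H t * X t)) has_integral deriv (deriv \<Lambda>3) 0) {0..1}"
      by (simp add: algebra_simps)
    from has_integral_unique[OF X(2) this] show ?thesis .
  qed
  have e3: "deriv (deriv \<Lambda>3) 0 =
      - 8 * pi\<^sup>2 * integral {0..1} G + 4 * pi\<^sup>2 * integral {0..1} (\<lambda>t. (H t)\<^sup>2)
      - 8 * pi\<^sup>2 * integral {0..1} (\<lambda>t. H t * C t)
      - 2 * pi * integral {0..1} (\<lambda>t. deriv H t * C t)"
    if C: "periodic_solution (\<lambda>t x. - 4 * pi\<^sup>2 * H t - pi * deriv H t) C" for C
  proof -
    have "periodic_solution (\<lambda>t x. 0) (\<lambda>t. C t - Y t)"
      using periodic_solution_diff[of "\<lambda>t. - 4 * pi\<^sup>2 * H t - pi * deriv H t" 0 C Y] C Y(1) by simp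
    from periodic_affine_constant[OF this] obtain m where m: "\<And>t. Y t = C t - m"
      by (metis add_diff_cancel_left' diff_add_cancel)
    have C_cont: "continuous_on {0..1} C" using C by (rule periodic_solution_continuous)
    \<comment> \<open>Passing from \<open>Y\<close> to \<open>C\<close> changes the integrand by
      multiples of \<open>H\<close> and \<open>deriv H\<close>. Both integrate to zero, the latter
      as the derivative of a periodic function.\<close>
    have Hm: "((\<lambda>t. H t * C t - H t * m) has_integral integral {0..1} (\<lambda>t. H t * C t) - 0 * m) {0..1}"
      by (intro has_integral_diff has_integral_mult_left H_int integrable_integral int continuous_intros
          H_cont C_cont)
    have H'm: "((\<lambda>t. deriv H t * C t - deriv H t * m) has_integral
        integral {0..1} (\<lambda>t. deriv H t * C t) - 0 * m) {0..1}"
      by (intro has_integral_diff has_integral_mult_left integrable_integral int continuous_intros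
          periodic_derivative_has_integral[OF H_smooth H_per] H'_cont C_cont)
    have "((\<lambda>t. - 8 * pi\<^sup>2 * G t + 4 * pi\<^sup>2 * (H t)\<^sup>2 - 8 * pi\<^sup>2 * (H t * C t - H t * m)
        - 2 * pi * (deriv H t * C t - deriv H t * m)) has_integral
        - 8 * pi\<^sup>2 * integral {0..1} G + 4 * pi\<^sup>2 * integral {0..1} (\<lambda>t. (H t)\<^sup>2)
        - 8 * pi\<^sup>2 * (integral {0..1} (\<lambda>t. H t * C t) - 0 * m)
        - 2 * pi * (integral {0..1} (\<lambda>t. deriv H t * C t) - 0 * m)) {0..1}"
      by (rule has_integral_diff[OF has_integral_diff[OF has_integral_add[OF
                has_integral_mult_right has_integral_mult_right]
              has_integral_mult_right[OF Hm]] has_integral_mult_right[OF H'm]];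
          rule integrable_integral; rule int; intro continuous_intros G_cont H_cont)
    moreover have "((\<lambda>t. - 8 * pi\<^sup>2 * G t + 4 * pi\<^sup>2 * (H t)\<^sup>2 - 8 * pi\<^sup>2 * (H t * C t - H t * m)
        - 2 * pi * (deriv H t * C t - deriv H t * m)) has_integral deriv (deriv \<Lambda>3) 0) {0..1}"
      using Y(2) by (simp add: m right_diff_distrib)
    ultimately show ?thesis
      by (simp add: has_integral_iff)
  qed
  show ?thesis
    unfolding Let_def
  proof (intro conjI)
    show "\<exists>C. periodic_solution (\<lambda>t x. - 4 * pi\<^sup>2 * H t - pi * deriv H t) C"
      using Y(1) by blast
    show "\<forall>C. periodic_solution (\<lambda>t x. - 4 * pi\<^sup>2 * H t - pi * deriv H t) C \<longrightarrow>
        deriv (deriv \<Lambda>2) 0 = deriv (deriv \<Lambda>3) 0 \<and> deriv (deriv \<Lambda>3) 0 =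
        - 8 * pi\<^sup>2 * integral {0..1} G + 4 * pi\<^sup>2 * integral {0..1} (\<lambda>t. (H t)\<^sup>2)
        - 8 * pi\<^sup>2 * integral {0..1} (\<lambda>t. H t * C t)
        - 2 * pi * integral {0..1} (\<lambda>t. deriv H t * C t)"
      using e23 e3 by blast
  qed (use a b c d in \<open>auto simp: algebra_simps\<close>)
qed

end
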